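(* Let $t(n)$ denote the number of partitions $\lambda$ of $n$ such that $\mathcal{O}(\lambda)\equiv\mathcal{O}(\lambda')\pmod 4$, let $p(n)$ be the number of partitions of $n$, and let $u(n)=p(n)-t(n)$. Put \[ V(q)=\frac{(q^2;q^2)^2_{\infty}(q^8;q^8)^2_{\infty}}{(q;q)^5_{\infty}(q^4;q^4)_{\infty}}. \] Then \begin{align*} \sum_{n=0}^{\infty}u(4n)q^{n}&=2q^2(q^{16};q^{16})_{\infty}(-q;q^{16})_{\infty}(-q^{15};q^{16})_{\infty}V(q),\\ \sum_{n=0}^{\infty}u(4n+1)q^{n}&=2q(q^{16};q^{16})_{\infty}(-q^3;q^{16})_{\infty}(-q^{13};q^{16})_{\infty}V(q),\\ \sum_{n=0}^{\infty}u(4n+2)q^{n}&=2(q^{16};q^{16})_{\infty}(-q^{7};q^{16})_{\infty}(-q^{9};q^{16})_{\infty}V(q),\\ \sum_{n=0}^{\infty}u(4n+3)q^{n}&=2(q^{16};q^{16})_{\infty}(-q^{5};q^{16})_{\infty}(-q^{11};q^{16})_{\infty}V(q). \end{align*}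
   Context: For a partition $\lambda$, $\lambda'$ denotes its conjugate partition and $\mathcal{O}(\lambda)$ denotes the number of odd parts of $\lambda$. For $|q|<1$, $(a;q)_\infty=\prod_{k\ge 0}(1-aq^k)$. *)

theory Defs
  imports "HOL-Analysis.Infinite_Products"
begin

definition partitions_of :: "nat \<Rightarrow> nat list set" where
  "partitions_of n = {xs. sorted_wrt (\<ge>) xs \<and> 0 \<notin> set xs \<and> sum_list xs = n}"

text \<open>The \<open>j\<close>-th part of the conjugate is the number of parts of \<open>xs\<close> that are at least \<open>j\<close>,
  for \<open>j\<close> from \<open>1\<close> up to the largest part, which is \<open>foldr max xs 0\<close> (and so is \<open>0\<close> for the
  empty partition).\<close>

definition conjugate :: "nat list \<Rightarrow> nat list" where
  "conjugate xs = map (\<lambda>j. length (filter (\<lambda>x. j \<le> x) xs)) [1..<Suc (foldr max xs 0)]"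

definition odd_parts :: "nat list \<Rightarrow> nat" where
  "odd_parts xs = length (filter odd xs)"

definition p_num :: "nat \<Rightarrow> nat" where
  "p_num n = card (partitions_of n)"

definition t_num :: "nat \<Rightarrow> nat" where
  "t_num n = card {xs \<in> partitions_of n. odd_parts xs mod 4 = odd_parts (conjugate xs) mod 4}"

definition u_num :: "nat \<Rightarrow> int" where
  "u_num n = int (p_num n) - int (t_num n)"

definition qpoch_inf :: "complex \<Rightarrow> complex \<Rightarrow> complex" where
  "qpoch_inf a q = (\<Prod>k. 1 - a * q ^ k)"

definition V_fun :: "complex \<Rightarrow> complex" where
  "V_fun q = (qpoch_inf (q^2) (q^2))^2 * (qpoch_inf (q^8) (q^8))^2 /
     ((qpoch_inf q q)^5 * qpoch_inf (q^4) (q^4))"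

end

theory Submission
  imports Defs "HOL-Analysis.Analysis"
begin

text \<open>Colour the Young diagram of a partition like a chessboard. Modulo 4, the difference of the
  numbers of odd parts of a partition and of its conjugate is twice the number of black cells, so
  \<open>p(n) - 2 u(n)\<close> counts the partitions of \<open>n\<close> with the sign \<open>(-1)\<close> to the number of black cells.
  Every domino covers one white and one black cell; decomposing a partition into its 2-core and
  2-quotient therefore suggests, for \<open>e = 1\<close> and \<open>e = -1\<close>, that partitions weighted by
  \<open>e\<close> to the number of black cells have the generating function \<open>(\<Sum>j. q^(2j\<^sup>2 - j)) / (e q\<^sup>2; e q\<^sup>2)\<^sup>2\<close>,
  where \<open>j\<close> runs over the integers and \<open>(a; q)\<close> is the infinite product.
  The proof avoids the bijection: the generating functions for partitions with parts at most \<open>N\<close> satisfy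
  a recurrence which determines them, and which the sums
  \<open>\<Sum>k+l=N. q^T(k-l) / ((P; P)\<^sub>k (P; P)\<^sub>l)\<close> with \<open>P = e q\<^sup>2\<close> and \<open>T(d) = d (d - 1) / 2\<close> satisfy as well.

  Subtracting the cases \<open>e = 1\<close> and \<open>e = -1\<close>, and expressing \<open>1 / (x; x)\<^sup>2 - 1 / (-x; -x)\<^sup>2\<close> for \<open>x = q\<^sup>2\<close>
  as the product \<open>4 x V(x\<^sup>2)\<close> by the Jacobi triple product, gives
  \<open>\<Sum>n. u(n) q\<^sup>n = 2 q\<^sup>2 V(q\<^sup>4) (\<Sum>j. q^(2j\<^sup>2 - j))\<close>. As \<open>2j\<^sup>2 - j\<close> is congruent to \<open>j\<close> modulo 4, each residue
  class of \<open>n\<close> modulo 4 selects a class of \<open>j\<close>, whose theta series is again a triple product.\<close>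

section \<open>Chessboard colouring of partitions\<close>

text \<open>The flag tells whether the first row starts with a white cell.\<close>

fun black_cells :: "bool \<Rightarrow> nat list \<Rightarrow> nat" where
  "black_cells b [] = 0"
| "black_cells b (x # xs) = (if b then x div 2 else (x + 1) div 2) + black_cells (\<not> b) xs"

lemma foldr_max_le_iff: "foldr max xs 0 \<le> (n::nat) \<longleftrightarrow> (\<forall>x\<in>set xs. x \<le> n)"
  by (induction xs) auto

lemma card_odd_even_interval:
  "card {j\<in>{1..x}. odd (f j)} + card {j\<in>{1..x::nat}. even (f j :: nat)} = x"
proof -
  have "card ({j\<in>{1..x}. odd (f j)} \<union> {j\<in>{1..x}. even (f j)}) =
        card {j\<in>{1..x}. odd (f j)} + card {j\<in>{1..x}. even (f j)}"
    by (rule card_Un_disjoint) auto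
  moreover have "{j\<in>{1..x}. odd (f j)} \<union> {j\<in>{1..x}. even (f j)} = {1..x}" by auto
  ultimately show ?thesis by simp
qed

lemma odd_parts_conjugate:
  "odd_parts (conjugate xs) = card {j\<in>{1..foldr max xs 0}. odd (length (filter (\<lambda>x. j \<le> x) xs))}"
proof -
  have "odd_parts (conjugate xs) =
    length (filter (\<lambda>j. odd (length (filter (\<lambda>x. j \<le> x) xs))) [1..<Suc (foldr max xs 0)])"
    unfolding odd_parts_def conjugate_def by (simp add: filter_map o_def del: upt_Suc)
  also have "\<dots> = card (set (filter (\<lambda>j. odd (length (filter (\<lambda>x. j \<le> x) xs))) [1..<Suc (foldr max xs 0)]))"
    by (rule distinct_card [symmetric]) simp
  also have "set (filter (\<lambda>j. odd (length (filter (\<lambda>x. j \<le> x) xs))) [1..<Suc (foldr max xs 0)]) =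
    {j\<in>{1..foldr max xs 0}. odd (length (filter (\<lambda>x. j \<le> x) xs))}"
    by auto
  finally show ?thesis .
qed

text \<open>A new first row of length \<open>x\<close>, at least as long as the others, adds one
  cell to each of the columns 1 to \<open>x\<close> and so flips the parity of its height. The odd
  columns of the new diagram are the even ones of the old, empty columns included.\<close>

lemma odd_parts_conjugate_Cons:
  assumes "\<forall>y\<in>set xs. y \<le> x"
  shows "odd_parts (conjugate (x # xs)) + odd_parts (conjugate xs) = x"
proof -
  let ?L = "\<lambda>j. length (filter (\<lambda>x. j \<le> x) xs)"
  have m: "foldr max xs 0 \<le> x" using assms by (simp add: foldr_max_le_iff)
  have "odd_parts (conjugate (x # xs)) = card {j\<in>{1..x}. even (?L j)}"
    unfolding odd_parts_conjugate using m by (intro arg_cong[of _ _ card]) (auto simp: max_def)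
  moreover have "odd_parts (conjugate xs) = card {j\<in>{1..x}. odd (?L j)}"
  proof -
    \<comment> \<open>Columns beyond the longest row are empty, so the range of columns may be
      extended to \<open>x\<close> when counting odd ones.\<close>
    have "j \<le> foldr max xs 0" if "odd (?L j)" for j
    proof (rule ccontr)
      assume "\<not> j \<le> foldr max xs 0"
      then have "filter (\<lambda>x. j \<le> x) xs = []"
        using foldr_max_le_iff[of xs "foldr max xs 0"] by (force simp: filter_empty_conv)
      then show False using that by simp
    qed
    then show ?thesis
      unfolding odd_parts_conjugate using m by (intro arg_cong[of _ _ card]) force
  qed
  ultimately show ?thesis using card_odd_even_interval[of x ?L] by simp
qed

text \<open>Adding a first row \<open>x\<close> swaps the colours of the other rows and replaces
  \<open>c\<close> odd columns by \<open>x - c\<close>. The difference of the two counts thus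
  becomes a sum and conversely, so the induction needs both congruences at once.\<close>

lemma odd_parts_black_cells:
  assumes "sorted_wrt (\<ge>) xs"
  shows "4 dvd int (odd_parts xs) - int (odd_parts (conjugate xs)) - 2 * int (black_cells True xs)"
    and "4 dvd int (odd_parts xs) + int (odd_parts (conjugate xs)) - 2 * int (black_cells False xs)"
proof -
  have "4 dvd int (odd_parts xs) - int (odd_parts (conjugate xs)) - 2 * int (black_cells True xs) \<and>
    4 dvd int (odd_parts xs) + int (odd_parts (conjugate xs)) - 2 * int (black_cells False xs)"
    using assms
  proof (induction xs)
    case Nil
    then show ?case by (simp add: odd_parts_def conjugate_def)
  next
    case (Cons x xs)
    let ?c = "odd_parts (conjugate xs)"
    have c: "int (odd_parts (conjugate (x # xs))) = int x - int ?c"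
      using odd_parts_conjugate_Cons[of xs x] Cons.prems by simp
    have o: "int (odd_parts (x # xs)) = int (x mod 2) + int (odd_parts xs)"
      by (auto simp: odd_parts_def mod2_eq_if)
    have x: "int x = 2 * int (x div 2) + int (x mod 2)" by presburger
    have x': "2 * int ((x + 1) div 2) = int x + int (x mod 2)" by presburger
    from Cons obtain k l where k: "int (odd_parts xs) - int ?c - 2 * int (black_cells True xs) = 4 * k"
      and l: "int (odd_parts xs) + int ?c - 2 * int (black_cells False xs) = 4 * l"
      by (auto elim!: dvdE)
    have "int (odd_parts (x # xs)) - int (odd_parts (conjugate (x # xs))) - 2 * int (black_cells True (x # xs))
       = 4 * (l - int (x div 2))"
      unfolding c o using l x by (simp del: of_nat_mod of_nat_div)
    moreover have "int (odd_parts (x # xs)) + int (odd_parts (conjugate (x # xs))) - 2 * int (black_cells False (x # xs))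
       = 4 * k"
      unfolding c o using k x' by (simp del: of_nat_mod of_nat_div)
    ultimately show ?case by (metis dvd_triv_left)
  qed
  then show "4 dvd int (odd_parts xs) - int (odd_parts (conjugate xs)) - 2 * int (black_cells True xs)"
    and "4 dvd int (odd_parts xs) + int (odd_parts (conjugate xs)) - 2 * int (black_cells False xs)"
    by auto
qed

lemma odd_parts_conjugate_mod_4_iff:
  assumes "sorted_wrt (\<ge>) xs"
  shows "odd_parts xs mod 4 = odd_parts (conjugate xs) mod 4 \<longleftrightarrow> even (black_cells True xs)"
  using odd_parts_black_cells(1)[OF assms] by presburger

section \<open>Coloured partitions with bounded parts\<close>

definition partitions_bounded :: "nat \<Rightarrow> nat \<Rightarrow> nat list set" where
  "partitions_bounded N n = {xs \<in> partitions_of n. \<forall>x\<in>set xs. x \<le> N}"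

lemma partitions_bounded_0: "partitions_bounded 0 n = (if n = 0 then {[]} else {})"
proof -
  have "xs \<in> partitions_bounded 0 n \<longleftrightarrow> n = 0 \<and> xs = []" for xs
    by (cases xs) (auto simp: partitions_bounded_def partitions_of_def)
  then show ?thesis by auto
qed

lemma partitions_bounded_Suc:
  "partitions_bounded (Suc N) n = partitions_bounded N n \<union>
     (if Suc N \<le> n then (#) (Suc N) ` partitions_bounded (Suc N) (n - Suc N) else {})"
proof -
  have "xs \<in> partitions_bounded (Suc N) n \<longleftrightarrow> xs \<in> partitions_bounded N n \<or>
    (Suc N \<le> n \<and> xs \<in> (#) (Suc N) ` partitions_bounded (Suc N) (n - Suc N))" for xs
  proof (cases xs)
    case (Cons y ys)
    then show ?thesis
      by (cases "y = Suc N") (auto simp: partitions_bounded_def partitions_of_def)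
  qed (auto simp: partitions_bounded_def partitions_of_def)
  then show ?thesis by auto
qed

lemma partitions_bounded_disjoint:
  "partitions_bounded N n \<inter> (#) (Suc N) ` A = {}"
  by (auto simp: partitions_bounded_def)

lemma partitions_bounded_eq: "n \<le> N \<Longrightarrow> partitions_bounded N n = partitions_of n"
  using member_le_sum_list by (fastforce simp: partitions_bounded_def partitions_of_def)

lemma finite_partitions_bounded [simp]: "finite (partitions_bounded N n)"
proof (induction N arbitrary: n)
  case 0
  then show ?case by (simp add: partitions_bounded_0)
next
  case (Suc N)
  show ?case
  proof (induction n rule: less_induct)
    case (less n)
    then show ?case by (subst partitions_bounded_Suc) (auto simp: Suc.IH)
  qed
qed

lemma finite_partitions_of [simp]: "finite (partitions_of n)"
  using finite_partitions_bounded[of n n] by (simp only: partitions_bounded_eq)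

definition coloured_count :: "'a::comm_ring_1 \<Rightarrow> bool \<Rightarrow> nat \<Rightarrow> nat \<Rightarrow> 'a" where
  "coloured_count e b N n = (\<Sum>xs\<in>partitions_bounded N n. e ^ black_cells b xs)"

lemma coloured_count_0: "coloured_count e b 0 n = (if n = 0 then 1 else 0)"
  by (simp add: coloured_count_def partitions_bounded_0)

text \<open>Split by whether the largest part equals \<open>Suc N\<close>. Removing a first row of
  that length takes away its black cells and leaves a diagram whose first cell has the other
  colour.\<close>

lemma coloured_count_Suc:
  "coloured_count e b (Suc N) n = coloured_count e b N n +
     (if Suc N \<le> n then e ^ (if b then Suc N div 2 else (Suc N + 1) div 2) *
        coloured_count e (\<not> b) (Suc N) (n - Suc N) else 0)"
proof (cases "Suc N \<le> n")
  case True
  have "coloured_count e b (Suc N) n = coloured_count e b N n +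
    (\<Sum>xs\<in>(#) (Suc N) ` partitions_bounded (Suc N) (n - Suc N). e ^ black_cells b xs)"
    unfolding coloured_count_def using True
    by (subst partitions_bounded_Suc)
      (simp add: sum.union_disjoint partitions_bounded_disjoint)
  also have "(\<Sum>xs\<in>(#) (Suc N) ` partitions_bounded (Suc N) (n - Suc N). e ^ black_cells b xs) =
    e ^ (if b then Suc N div 2 else (Suc N + 1) div 2) * coloured_count e (\<not> b) (Suc N) (n - Suc N)"
    unfolding coloured_count_def
    by (subst sum.reindex) (auto simp: sum_distrib_left power_add o_def)
  finally show ?thesis using True by simp
next
  case False
  then show ?thesis unfolding coloured_count_def
    by (subst partitions_bounded_Suc) simp
qed

lemma coloured_count_stable: "n \<le> N \<Longrightarrow> coloured_count e b N n = coloured_count e b n n"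
  by (simp add: coloured_count_def partitions_bounded_eq)

lemma coloured_count_1: "coloured_count 1 b N n = of_nat (card (partitions_bounded N n))"
  by (simp add: coloured_count_def)

text \<open>At \<open>e = -1\<close> the partitions with evenly many black cells count positively
  and the others negatively, which gives 2 t(n) - p(n).\<close>

lemma u_num_coloured_count:
  "2 * u_num n = coloured_count 1 True n n - coloured_count (-1) True n n"
proof -
  let ?P = "partitions_of n" and ?E = "{xs \<in> partitions_of n. even (black_cells True xs)}"
  have t: "t_num n = card ?E"
    unfolding t_num_def
    by (intro arg_cong[of _ _ card]) (auto simp: partitions_of_def odd_parts_conjugate_mod_4_iff)
  have "coloured_count (-1) True n n = (\<Sum>xs\<in>?P. 2 * of_bool (even (black_cells True xs)) - 1 :: int)"
    unfolding coloured_count_def partitions_bounded_eq[OF order_refl]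
    by (intro sum.cong) auto
  also have "\<dots> = 2 * int (card ?E) - int (card ?P)"
    by (simp add: sum_subtractf flip: sum_distrib_left) (simp add: Int_def)
  finally show ?thesis
    by (simp add: coloured_count_1 u_num_def p_num_def t partitions_bounded_eq)
qed

text \<open>These constant terms of the four series settle the theorem at q = 0, where the general
  argument cannot divide by powers of a fourth root of q.\<close>

lemma u_num_small: "u_num 0 = 0" "u_num 1 = 0" "u_num 2 = 2" "u_num 3 = 2"
proof -
  have d: "Suc (Suc (Suc 0)) div Suc (Suc 0) = 1" by presburger
  show "u_num 0 = 0" "u_num 1 = 0" "u_num 2 = 2" "u_num 3 = 2"
    using u_num_coloured_count[of 0] u_num_coloured_count[of 1]
      u_num_coloured_count[of 2] u_num_coloured_count[of 3]
    by (simp_all add: numeral_eq_Suc coloured_count_0 coloured_count_Suc d)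
qed

section \<open>The Jacobi triple product\<close>

text \<open>Dominated convergence for unordered series: by the Weierstrass M-test the finite partial
  sums converge uniformly in \<open>n\<close>, so the two limits may be exchanged.\<close>

lemma tannery:
  fixes f :: "nat \<Rightarrow> 'i \<Rightarrow> 'b::banach"
  assumes "\<And>n x. norm (f n x) \<le> M x" "M summable_on UNIV"
    and "\<And>x. (\<lambda>n. f n x) \<longlonglongrightarrow> g x"
  shows "(\<lambda>n. \<Sum>\<^sub>\<infinity>x. f n x) \<longlonglongrightarrow> (\<Sum>\<^sub>\<infinity>x. g x)"
proof (rule swap_uniform_limit')
  have "norm (g x) \<le> M x" for x
    by (rule Lim_norm_ubound[OF _ assms(3)]) (use assms(1) in auto)
  then have "(\<lambda>x. norm (g x)) summable_on UNIV"
    by (intro summable_on_comparison_test[OF assms(2)]) auto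
  then have "g summable_on UNIV" by (rule abs_summable_summable)
  then show "((\<lambda>X. \<Sum>x\<in>X. g x) \<longlongrightarrow> (\<Sum>\<^sub>\<infinity>x. g x)) (finite_subsets_at_top UNIV)"
    by (rule infsum_tendsto)
  show "uniform_limit UNIV (\<lambda>X n. \<Sum>x\<in>X. f n x) (\<lambda>n. \<Sum>\<^sub>\<infinity>x. f n x) (finite_subsets_at_top UNIV)"
    by (rule Weierstrass_m_test_general) (use assms in auto)
  show "\<forall>\<^sub>F X in finite_subsets_at_top UNIV. (\<lambda>n. \<Sum>x\<in>X. f n x) \<longlonglongrightarrow> (\<Sum>x\<in>X. g x)"
    by (intro always_eventually allI tendsto_sum assms(3))
qed auto

text \<open>For every integer \<open>d\<close> the product d (d - 1) is even and nonnegative, so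
  neither \<open>div\<close> nor \<open>nat\<close> loses anything and the value can serve as an
  exponent.\<close>

definition tri :: "int \<Rightarrow> nat" where
  "tri d = nat (d * (d - 1) div 2)"

lemma two_int_tri: "2 * int (tri d) = d * (d - 1)"
proof -
  have "even (d * (d - 1))" by auto
  moreover have "0 \<le> d * (d - 1)" by (cases "d \<le> 0") (auto simp: mult_nonpos_nonpos)
  ultimately show ?thesis by (simp add: tri_def)
qed

lemma int_tri_Suc: "int (tri (d + 1)) = int (tri d) + d"
  using two_int_tri[of d] two_int_tri[of "d + 1"] by (simp add: algebra_simps)

lemma tri_flip: "tri (1 - d) = tri d"
  by (simp add: tri_def algebra_simps)

section \<open>Sums with q-binomial weights and the finite triple product\<close>

definition inv_qpoch :: "'a::field \<Rightarrow> nat \<Rightarrow> 'a" where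
  "inv_qpoch P n = (\<Prod>i<n. inverse (1 - P ^ Suc i))"

lemma inv_qpoch_Suc:
  "P ^ Suc n \<noteq> 1 \<Longrightarrow> (1 - P ^ Suc n) * inv_qpoch P (Suc n) = inv_qpoch P n"
  by (simp add: inv_qpoch_def)

text \<open>Up to the factor (P; P)_N, this sums \<open>g k\<close> against the Gaussian binomial
  coefficients in base \<open>P\<close>.\<close>

definition qconv :: "'a::field \<Rightarrow> (nat \<Rightarrow> 'a) \<Rightarrow> nat \<Rightarrow> 'a" where
  "qconv P g N = (\<Sum>k\<le>N. g k * (inv_qpoch P k * inv_qpoch P (N - k)))"

lemma qconv_cong: "(\<And>k. k \<le> N \<Longrightarrow> g k = h k) \<Longrightarrow> qconv P g N = qconv P h N"
  unfolding qconv_def by (rule sum.cong) auto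

lemma qconv_add: "qconv P (\<lambda>k. g k + h k) N = qconv P g N + qconv P h N"
  by (simp add: qconv_def sum.distrib ring_distribs)

lemma qconv_diff: "qconv P (\<lambda>k. g k - h k) N = qconv P g N - qconv P h N"
  by (simp add: qconv_def sum_subtractf ring_distribs)

lemma qconv_cmult: "qconv P (\<lambda>k. c * g k) N = c * qconv P g N"
  by (simp add: qconv_def sum_distrib_left mult_ac)

lemma qconv_rev: "qconv P (\<lambda>k. g (N - k)) N = qconv P g N"
  unfolding qconv_def by (rule sum.reindex_bij_witness[of _ "\<lambda>k. N - k" "\<lambda>k. N - k"]) auto

text \<open>The extra factor vanishes at \<open>k = 0\<close> and otherwise cancels the last factor
  of \<open>inv_qpoch P k\<close>.\<close>

lemma qconv_reduce_left:
  assumes "\<And>n. P ^ Suc n \<noteq> 1"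
  shows "qconv P (\<lambda>k. g k * (1 - P ^ k)) (Suc N) = qconv P (\<lambda>k. g (Suc k)) N"
proof -
  have "qconv P (\<lambda>k. g k * (1 - P ^ k)) (Suc N) =
    (\<Sum>k\<le>N. g (Suc k) * (((1 - P ^ Suc k) * inv_qpoch P (Suc k)) * inv_qpoch P (N - k)))"
    unfolding qconv_def by (subst sum.atMost_Suc_shift) (simp add: mult_ac)
  then show ?thesis by (simp only: inv_qpoch_Suc[OF assms] qconv_def)
qed

lemma qconv_reduce_right:
  assumes "\<And>n. P ^ Suc n \<noteq> 1"
  shows "qconv P (\<lambda>k. g k * (1 - P ^ (Suc N - k))) (Suc N) = qconv P g N"
proof -
  have "qconv P (\<lambda>k. g k * (1 - P ^ (Suc N - k))) (Suc N) =
    qconv P (\<lambda>k. g (Suc N - k) * (1 - P ^ k)) (Suc N)"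
    by (subst qconv_rev [symmetric]) (intro qconv_cong, simp)
  also have "\<dots> = qconv P (\<lambda>k. g (Suc N - Suc k)) N"
    by (rule qconv_reduce_left[OF assms])
  also have "\<dots> = qconv P g N"
    by (subst (2) qconv_rev [symmetric]) simp
  finally show ?thesis .
qed

text \<open>A q-Pascal rule: for k + l = N + 1, write 1 - P^(k+l) as (1 - P^k) + P^k (1 - P^l) and
  let each bracket cancel a factor on its side.\<close>

lemma qconv_split_left:
  assumes "\<And>n. P ^ Suc n \<noteq> 1"
  shows "(1 - P ^ Suc N) * qconv P g (Suc N) =
    qconv P (\<lambda>k. g (Suc k)) N + qconv P (\<lambda>k. P ^ k * g k) N"
proof -
  have "(1 - P ^ Suc N) * qconv P g (Suc N) =
    qconv P (\<lambda>k. g k * (1 - P ^ k) + P ^ k * g k * (1 - P ^ (Suc N - k))) (Suc N)"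
    unfolding qconv_cmult [symmetric]
  proof (rule qconv_cong)
    fix k assume "k \<le> Suc N"
    then have "P ^ Suc N = P ^ k * P ^ (Suc N - k)" by (simp flip: power_add)
    then show "(1 - P ^ Suc N) * g k = g k * (1 - P ^ k) + P ^ k * g k * (1 - P ^ (Suc N - k))"
      by (simp only:) (simp add: algebra_simps)
  qed
  then show ?thesis
    by (simp only: qconv_add qconv_reduce_left[OF assms] qconv_reduce_right[OF assms])
qed

text \<open>The companion q-Pascal rule, obtained by reversing the summation.\<close>

lemma qconv_split_right:
  assumes "\<And>n. P ^ Suc n \<noteq> 1"
  shows "(1 - P ^ Suc N) * qconv P g (Suc N) =
    qconv P g N + qconv P (\<lambda>k. P ^ (N - k) * g (Suc k)) N"
proof -
  have "(1 - P ^ Suc N) * qconv P g (Suc N) = (1 - P ^ Suc N) * qconv P (\<lambda>k. g (Suc N - k)) (Suc N)"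
    by (simp only: qconv_rev)
  also have "\<dots> = qconv P (\<lambda>k. g (N - k)) N + qconv P (\<lambda>k. P ^ k * g (Suc N - k)) N"
    by (subst qconv_split_left[OF assms]) simp
  also have "qconv P (\<lambda>k. P ^ k * g (Suc N - k)) N = qconv P (\<lambda>k. P ^ (N - k) * g (Suc k)) N"
    by (subst qconv_rev [symmetric]) (intro qconv_cong, simp add: Suc_diff_le)
  finally show ?thesis by (simp only: qconv_rev)
qed

text \<open>The general term of Ramanujan's theta function f(a, b), with exponents j (j + 1) / 2 and
  j (j - 1) / 2.\<close>

definition theta_term :: "'a::field \<Rightarrow> 'a \<Rightarrow> int \<Rightarrow> 'a" where
  "theta_term a b j = a ^ tri (j + 1) * b ^ tri j"

text \<open>Besides the sums for \<open>2 * m\<close>, the induction passes through the sum \<open>?O\<close> for \<open>2 * m + 1\<close>: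
  the step to \<open>?O\<close> produces the factor \<open>1 + b P\<^sup>m\<close>, the next one \<open>1 + a P\<^sup>m\<close>.\<close>

lemma finite_jacobi_triple:
  fixes a b :: "'a::field"
  defines "P \<equiv> a * b"
  assumes "\<And>n. P ^ Suc n \<noteq> 1"
  shows "qconv P (\<lambda>k. theta_term a b (int k - int m)) (2 * m) =
    (\<Prod>i<m. 1 + a * P ^ i) * (\<Prod>i<m. 1 + b * P ^ i) * inv_qpoch P (2 * m)"
proof (induction m)
  case 0
  then show ?case by (simp add: qconv_def theta_term_def tri_def inv_qpoch_def)
next
  case (Suc m)
  let ?E = "\<lambda>m. qconv P (\<lambda>k. theta_term a b (int k - int m)) (2 * m)"
  let ?O = "qconv P (\<lambda>k. theta_term a b (int k - int m - 1)) (Suc (2 * m))"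
  have 1: "(1 - P ^ Suc (2 * m)) * ?O = (1 + b * P ^ m) * ?E m"
  proof -
    have "P ^ k * theta_term a b (int k - int m - 1) = b * P ^ m * theta_term a b (int k - int m)" for k
    proof -
      define j where "j = int k - int m"
      \<comment> \<open>Since T(j + 1) - T(j) = j = k - m, the factor \<open>P ^ k\<close> is
        absorbed by the exponents of \<open>a\<close> and of \<open>b\<close> separately.\<close>
      have "tri j + k = tri (j + 1) + m" "tri (j - 1) + k = tri j + Suc m"
        using int_tri_Suc[of j] int_tri_Suc[of "j - 1"] by (simp_all add: j_def)
      then have "a ^ tri j * a ^ k = a ^ tri (j + 1) * a ^ m" "b ^ tri (j - 1) * b ^ k = b ^ tri j * b ^ Suc m"
        by (simp_all flip: power_add power_Suc)
      then have "(a ^ tri j * a ^ k) * (b ^ tri (j - 1) * b ^ k) =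
         (a ^ tri (j + 1) * a ^ m) * (b ^ tri j * b ^ Suc m)" by simp
      then show ?thesis unfolding j_def [symmetric] theta_term_def
        by (simp add: P_def power_mult_distrib mult_ac)
    qed
    then have "qconv P (\<lambda>k. P ^ k * theta_term a b (int k - int m - 1)) (2 * m) = b * P ^ m * ?E m"
      by (simp only: qconv_cmult)
    then show ?thesis
      by (subst qconv_split_left[OF assms(2)]) (simp add: algebra_simps)
  qed
  have 2: "(1 - P ^ Suc (Suc (2 * m))) * ?E (Suc m) = (1 + a * P ^ m) * ?O"
  proof -
    have "P ^ (Suc (2 * m) - k) * theta_term a b (int k - int m) = a * P ^ m * theta_term a b (int k - int m - 1)"
      if "k \<le> Suc (2 * m)" for k
    proof -
      define j l where "j = int k - int m - 1" and "l = Suc (2 * m) - k"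
      have "int l = int m - j" using that by (simp add: j_def l_def)
      then have "tri (j + 2) + l = tri (j + 1) + Suc m" "tri (j + 1) + l = tri j + m"
        using int_tri_Suc[of j] int_tri_Suc[of "j + 1"] by (simp_all add: add.commute)
      then have "a ^ tri (j + 2) * a ^ l = a ^ tri (j + 1) * a ^ Suc m" "b ^ tri (j + 1) * b ^ l = b ^ tri j * b ^ m"
        by (simp_all flip: power_add power_Suc)
      then have "(a ^ tri (j + 2) * a ^ l) * (b ^ tri (j + 1) * b ^ l) =
         (a ^ tri (j + 1) * a ^ Suc m) * (b ^ tri j * b ^ m)" by simp
      moreover have "int k - int m = j + 1" by (simp add: j_def)
      ultimately show ?thesis unfolding l_def [symmetric] j_def [symmetric] theta_term_def
        by (simp add: P_def power_mult_distrib mult_ac add.commute)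
    qed
    then have "qconv P (\<lambda>k. P ^ (Suc (2 * m) - k) * theta_term a b (int k - int m)) (Suc (2 * m)) = a * P ^ m * ?O"
      unfolding qconv_cmult [symmetric] by (intro qconv_cong) auto
    \<comment> \<open>Both \<open>?E (Suc m)\<close> and \<open>?O\<close> have the offset m + 1, so
      they differ only in the length of the sum.\<close>
    moreover have "?E (Suc m) = qconv P (\<lambda>k. theta_term a b (int k - int m - 1)) (Suc (Suc (2 * m)))"
      by (simp add: algebra_simps)
    ultimately show ?thesis
      by (simp only:) (subst qconv_split_right[OF assms(2)], simp add: algebra_simps)
  qed
  have 3: "(1 - P ^ Suc (Suc (2 * m))) * (1 - P ^ Suc (2 * m)) * inv_qpoch P (2 * Suc m) = inv_qpoch P (2 * m)"
  proof -
    have "(1 - P ^ Suc (Suc (2 * m))) * (1 - P ^ Suc (2 * m)) * inv_qpoch P (2 * Suc m) =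
      (1 - P ^ Suc (2 * m)) * ((1 - P ^ Suc (Suc (2 * m))) * inv_qpoch P (Suc (Suc (2 * m))))"
      by (simp add: mult_ac)
    also have "\<dots> = inv_qpoch P (2 * m)" by (simp only: inv_qpoch_Suc[OF assms(2)])
    finally show ?thesis .
  qed
  have "(1 - P ^ Suc (Suc (2 * m))) * (1 - P ^ Suc (2 * m)) * ?E (Suc m) =
    (1 + a * P ^ m) * ((1 - P ^ Suc (2 * m)) * ?O)"
    using 2 by (simp only: mult_ac)
  also have "\<dots> = (1 + a * P ^ m) * (1 + b * P ^ m) * ((\<Prod>i<m. 1 + a * P ^ i) * (\<Prod>i<m. 1 + b * P ^ i) * inv_qpoch P (2 * m))"
    unfolding 1 Suc.IH by (simp only: mult_ac)
  also have "\<dots> = (\<Prod>i<Suc m. 1 + a * P ^ i) * (\<Prod>i<Suc m. 1 + b * P ^ i) *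
     ((1 - P ^ Suc (Suc (2 * m))) * (1 - P ^ Suc (2 * m)) * inv_qpoch P (2 * Suc m))"
    unfolding 3 by (simp add: mult_ac)
  finally have *: "(1 - P ^ Suc (Suc (2 * m))) * (1 - P ^ Suc (2 * m)) * ?E (Suc m) =
    (1 - P ^ Suc (Suc (2 * m))) * (1 - P ^ Suc (2 * m)) *
    ((\<Prod>i<Suc m. 1 + a * P ^ i) * (\<Prod>i<Suc m. 1 + b * P ^ i) * inv_qpoch P (2 * Suc m))"
    by (simp only: mult_ac)
  have "(1 - P ^ Suc (Suc (2 * m))) * (1 - P ^ Suc (2 * m)) \<noteq> 0"
    using assms(2)[of "2 * m"] assms(2)[of "Suc (2 * m)"] by (simp del: power_Suc)
  from mult_left_cancel[OF this, THEN iffD1, OF *] show ?case .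
qed

lemma theta_term_cube: "theta_term q (q ^ 3) = (\<lambda>j. q ^ tri (2 * j))"
proof
  fix j
  have "tri (2 * j) = tri (j + 1) + 3 * tri j"
    using two_int_tri[of j] two_int_tri[of "2 * j"] int_tri_Suc[of j] by (simp add: algebra_simps)
  then show "theta_term q (q ^ 3) j = q ^ tri (2 * j)"
    by (simp add: theta_term_def power_add power_mult)
qed


section \<open>Convergence of the infinite products\<close>

lemma convergent_qpoch:
  fixes a q :: "'a::{real_normed_field, banach}"
  assumes "norm q < 1"
  shows "convergent_prod (\<lambda>k. 1 - a * q ^ k)"
proof -
  have "summable (\<lambda>k. norm (1 - a * q ^ k - 1))"
    using assms by (simp add: norm_mult norm_power summable_mult summable_geometric)
  then show ?thesis
    by (intro abs_convergent_prod_imp_convergent_prod summable_imp_abs_convergent_prod)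
qed

lemma qpoch_factor_nonzero:
  fixes a q :: "'a::real_normed_field"
  assumes "norm a < 1" "norm q < 1"
  shows "1 - a * q ^ k \<noteq> 0"
proof
  assume "1 - a * q ^ k = 0"
  then have "norm (a * q ^ k) = 1" by simp
  moreover have "norm (a * q ^ k) \<le> norm a * 1"
    unfolding norm_mult norm_power using assms by (intro mult_left_mono power_le_one) auto
  ultimately show False using assms by simp
qed

lemma qpoch_inf_LIMSEQ:
  assumes "norm q < 1"
  shows "(\<lambda>n. \<Prod>k<n. 1 - a * q ^ k) \<longlonglongrightarrow> qpoch_inf a q"
proof -
  have "(\<lambda>k. 1 - a * q ^ k) has_prod qpoch_inf a q"
    unfolding qpoch_inf_def by (rule convergent_prod_has_prod[OF convergent_qpoch[OF assms]])
  then show ?thesis by (rule has_prod_imp_tendsto')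
qed

lemma qpoch_inf_nonzero:
  assumes "norm a < 1" "norm q < 1"
  shows "qpoch_inf a q \<noteq> 0"
  unfolding qpoch_inf_def
  by (intro prodinf_nonzero convergent_qpoch qpoch_factor_nonzero assms)

lemma inv_qpoch_LIMSEQ:
  assumes "norm P < 1"
  shows "(\<lambda>n. inv_qpoch P n) \<longlonglongrightarrow> inverse (qpoch_inf P P)"
proof -
  have "inv_qpoch P n = inverse (\<Prod>k<n. 1 - P * P ^ k)" for n
    by (simp add: inv_qpoch_def prod_inversef [symmetric] o_def)
  then show ?thesis
    using assms by (simp add: tendsto_inverse qpoch_inf_LIMSEQ qpoch_inf_nonzero)
qed

lemma inv_qpoch_of_real: "of_real (inv_qpoch r n) = (inv_qpoch (of_real r) n :: complex)"
  by (simp add: inv_qpoch_def)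

lemma inv_qpoch_bounded:
  assumes "norm (P::complex) < 1"
  obtains C where "\<And>n. norm (inv_qpoch P n) \<le> C" "C > 0"
  using convergent_imp_Bseq[OF convergentI[OF inv_qpoch_LIMSEQ[OF assms]]]
  by (auto simp: Bseq_def)

lemma inv_qpoch_real_bounded:
  assumes "0 \<le> r" "r < (1::real)"
  obtains C where "\<And>n. inv_qpoch r n \<le> C"
proof -
  obtain C where "\<And>n. norm (inv_qpoch (of_real r :: complex) n) \<le> C"
    using inv_qpoch_bounded[of "of_real r"] assms by auto
  then have "\<And>n. norm (inv_qpoch r n) \<le> C"
    by (metis inv_qpoch_of_real norm_of_real real_norm_def)
  then show ?thesis by (intro that[of C]) (auto intro: order_trans[OF abs_ge_self])
qed

lemma inv_qpoch_ge_1: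
  assumes "0 \<le> r" "r < (1::real)"
  shows "1 \<le> inv_qpoch r n"
  unfolding inv_qpoch_def
proof (rule prod_ge_1)
  fix i
  have "r ^ Suc i < 1" using power_Suc_le_self[of r i] assms by linarith
  moreover have "0 \<le> r ^ Suc i" using assms by simp
  ultimately show "1 \<le> inverse (1 - r ^ Suc i)" by (intro one_le_inverse) auto
qed

lemma power_Suc_neq_1:
  fixes P :: "'a::real_normed_field"
  assumes "norm P < 1"
  shows "P ^ Suc n \<noteq> 1"
proof
  assume "P ^ Suc n = 1"
  then have "norm P ^ Suc n = 1" by (metis norm_one norm_power)
  then show False using power_Suc_le_self[of "norm P" n] assms by simp
qed

section \<open>Passage to the limit in the finite triple product\<close>

lemma qconv_int_sum:
  "qconv P (\<lambda>k. w (int k - int m)) (2 * m) =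
    (\<Sum>j\<in>{-int m..int m}. w j * (inv_qpoch P (nat (int m + j)) * inv_qpoch P (nat (int m - j))))"
  unfolding qconv_def
  by (rule sum.reindex_bij_witness[of _ "\<lambda>j. nat (int m + j)" "\<lambda>k. int k - int m"])
    (auto simp: nat_diff_distrib intro!: arg_cong[of _ _ "inv_qpoch P"])

text \<open>After centring the sum at \<open>k = m\<close>, both \<open>inv_qpoch\<close> factors of
  a fixed term tend to the inverse infinite product. Their common bound \<open>C\<close> provides
  the summable majorant \<open>norm (w j) * (C * C)\<close>.\<close>

lemma qconv_LIMSEQ:
  fixes w :: "int \<Rightarrow> complex"
  assumes P: "norm P < 1" and w: "(\<lambda>j. norm (w j)) summable_on UNIV"
  shows "(\<lambda>m. qconv P (\<lambda>k. w (int k - int m)) (2 * m)) \<longlonglongrightarrow> (\<Sum>\<^sub>\<infinity>j. w j) / qpoch_inf P P ^ 2"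
proof -
  obtain C where C: "\<And>n. norm (inv_qpoch P n) \<le> C" "C > 0"
    using inv_qpoch_bounded[OF P] by blast
  define f where "f m j = (if j \<in> {-int m..int m} then
     w j * (inv_qpoch P (nat (int m + j)) * inv_qpoch P (nat (int m - j))) else 0)" for m j
  have "(\<lambda>m. \<Sum>\<^sub>\<infinity>j. f m j) \<longlonglongrightarrow> (\<Sum>\<^sub>\<infinity>j. w j * (inverse (qpoch_inf P P))\<^sup>2)"
  proof (rule tannery)
    show "norm (f m j) \<le> norm (w j) * (C * C)" for m j
      using C by (auto simp: f_def norm_mult intro!: mult_mono mult_left_mono)
    show "(\<lambda>j. norm (w j) * (C * C)) summable_on UNIV"
      by (intro summable_on_cmult_left w)
    show "(\<lambda>m. f m j) \<longlonglongrightarrow> w j * (inverse (qpoch_inf P P))\<^sup>2" for j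
    proof -
      have 1: "filterlim (\<lambda>m. nat (int m + j)) sequentially sequentially" for j
        unfolding filterlim_at_top
      proof
        fix Z
        show "\<forall>\<^sub>F m in sequentially. Z \<le> nat (int m + j)"
          using eventually_ge_at_top[of "Z + nat (- j)"] by eventually_elim auto
      qed
      have "(\<lambda>m. w j * (inv_qpoch P (nat (int m + j)) * inv_qpoch P (nat (int m + (- j))))) \<longlonglongrightarrow>
         w j * (inverse (qpoch_inf P P) * inverse (qpoch_inf P P))"
        by (intro tendsto_intros filterlim_compose[OF inv_qpoch_LIMSEQ[OF P]] 1)
      moreover have "\<forall>\<^sub>F m in sequentially. f m j =
         w j * (inv_qpoch P (nat (int m + j)) * inv_qpoch P (nat (int m + (- j))))"
        using eventually_ge_at_top[of "nat \<bar>j\<bar>"] by eventually_elim (auto simp: f_def)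
      ultimately show ?thesis
        by (subst tendsto_cong) (auto simp: power2_eq_square)
    qed
  qed
  moreover have "(\<Sum>\<^sub>\<infinity>j. f m j) = qconv P (\<lambda>k. w (int k - int m)) (2 * m)" for m
    unfolding qconv_int_sum
    by (subst infsum_cong_neutral[of "{-int m..int m}" UNIV _ "f m"]) (auto simp: f_def intro!: infsum_cong)
  moreover have "(\<Sum>\<^sub>\<infinity>j. w j * (inverse (qpoch_inf P P))\<^sup>2) = (\<Sum>\<^sub>\<infinity>j. w j) / qpoch_inf P P ^ 2"
    by (subst infsum_cmult_left') (simp add: field_simps)
  ultimately show ?thesis by simp
qed

text \<open>For nonnegative parameters the finite identity bounds the partial sums of the theta series,
  because \<^term>\<open>inv_qpoch P k\<close> is at least 1.\<close>

lemma summable_theta_real: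
  fixes a b :: real
  assumes "0 \<le> a" "0 \<le> b" "a * b < 1"
  shows "theta_term a b summable_on UNIV"
proof -
  define P where "P = a * b"
  have P: "0 \<le> P" "P < 1" using assms by (auto simp: P_def)
  obtain C where C: "\<And>n. inv_qpoch P n \<le> C" using inv_qpoch_real_bounded[OF P] by blast
  \<comment> \<open>The inequality 1 + x \<le> exp x and a geometric series bound the product
    independently of \<open>m\<close>.\<close>
  have bound: "(\<Prod>i<m. 1 + c * P ^ i) \<le> exp (c / (1 - P))" if "0 \<le> c" for c m
  proof -
    have "(\<Prod>i<m. 1 + c * P ^ i) \<le> (\<Prod>i<m. exp (c * P ^ i))"
      using that P by (intro prod_mono) (auto simp: add_nonneg_nonneg)
    also have "\<dots> = exp (\<Sum>i<m. c * P ^ i)" by (simp add: exp_sum)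
    also have "(\<Sum>i<m. c * P ^ i) \<le> (\<Sum>i. c * P ^ i)"
      using that P by (intro sum_le_suminf summable_mult summable_geometric) auto
    also have "(\<Sum>i. c * P ^ i) = c / (1 - P)"
      using P by (subst suminf_mult) (auto simp: suminf_geometric summable_geometric)
    finally show ?thesis by simp
  qed
  have nonneg: "0 \<le> theta_term a b j" for j
    using assms by (simp add: theta_term_def)
  have "sum (theta_term a b) F \<le> exp (a / (1 - P)) * exp (b / (1 - P)) * C" if "finite F" for F
  proof -
    obtain m where m: "F \<subseteq> {-int m..int m}"
    proof -
      have "\<bar>x\<bar> \<le> Max (abs ` F)" if "x \<in> F" for x
        using that \<open>finite F\<close> by simp
      then show ?thesis by (intro that[of "nat (Max (abs ` F))"]) force
    qed
    have "sum (theta_term a b) F \<le> sum (theta_term a b) {-int m..int m}"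
      using m nonneg by (intro sum_mono2) auto
    also have "\<dots> \<le> qconv P (\<lambda>k. theta_term a b (int k - int m)) (2 * m)"
      unfolding qconv_int_sum
    proof (rule sum_mono)
      fix j
      have "1 * 1 \<le> inv_qpoch P (nat (int m + j)) * inv_qpoch P (nat (int m - j))"
        using inv_qpoch_ge_1[OF P] by (intro mult_mono) (auto intro: order_trans[OF zero_le_one])
      then show "theta_term a b j \<le> theta_term a b j * (inv_qpoch P (nat (int m + j)) * inv_qpoch P (nat (int m - j)))"
        using nonneg[of j] mult_left_mono by fastforce
    qed
    also have "\<dots> = (\<Prod>i<m. 1 + a * P ^ i) * (\<Prod>i<m. 1 + b * P ^ i) * inv_qpoch P (2 * m)"
      unfolding P_def by (intro finite_jacobi_triple power_Suc_neq_1) (use P in \<open>simp add: P_def\<close>)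
    also have "\<dots> \<le> exp (a / (1 - P)) * exp (b / (1 - P)) * C"
      using bound[of a m] bound[of b m] C[of "2 * m"] inv_qpoch_ge_1[OF P, of "2 * m"] assms P
      by (intro mult_mono prod_nonneg mult_nonneg_nonneg) (auto simp: add_nonneg_nonneg)
    finally show ?thesis .
  qed
  then show ?thesis
    using nonneg by (intro nonneg_bdd_above_summable_on) (auto intro!: bdd_aboveI2)
qed

lemma summable_theta:
  fixes a b :: complex
  assumes "norm (a * b) < 1"
  shows "(\<lambda>j. norm (theta_term a b j)) summable_on UNIV"
proof -
  have "norm (theta_term a b j) = theta_term (norm a) (norm b) j" for j
    by (simp add: theta_term_def norm_mult norm_power)
  then show ?thesis
    using summable_theta_real[of "norm a" "norm b"] assms by (simp add: norm_mult)
qed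

text \<open>In the finite identity the left side tends to the theta series divided by (P; P)^2, the
  right side to the product of the other two factors divided by (P; P).\<close>

theorem jacobi_triple:
  fixes a b :: complex
  assumes "norm (a * b) < 1"
  shows "(theta_term a b has_sum
    qpoch_inf (- a) (a * b) * qpoch_inf (- b) (a * b) * qpoch_inf (a * b) (a * b)) UNIV"
proof -
  let ?P = "a * b"
  have "(\<lambda>m. qconv ?P (\<lambda>k. theta_term a b (int k - int m)) (2 * m)) \<longlonglongrightarrow>
     (\<Sum>\<^sub>\<infinity>j. theta_term a b j) / qpoch_inf ?P ?P ^ 2"
    by (intro qconv_LIMSEQ summable_theta assms)
  moreover have "(\<lambda>m. qconv ?P (\<lambda>k. theta_term a b (int k - int m)) (2 * m)) \<longlonglongrightarrow>
     qpoch_inf (- a) ?P * qpoch_inf (- b) ?P * inverse (qpoch_inf ?P ?P)"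
  proof -
    have "filterlim (\<lambda>m::nat. 2 * m) sequentially sequentially"
      by (simp add: filterlim_subseq strict_mono_def)
    note 1 = filterlim_compose[OF inv_qpoch_LIMSEQ[OF assms] this]
    show ?thesis
      unfolding finite_jacobi_triple[OF power_Suc_neq_1[OF assms]]
      using qpoch_inf_LIMSEQ[OF assms, of "- a"] qpoch_inf_LIMSEQ[OF assms, of "- b"] 1
      by (intro tendsto_mult) auto
  qed
  ultimately have "(\<Sum>\<^sub>\<infinity>j. theta_term a b j) / qpoch_inf ?P ?P ^ 2 =
     qpoch_inf (- a) ?P * qpoch_inf (- b) ?P * inverse (qpoch_inf ?P ?P)"
    by (rule LIMSEQ_unique)
  then have "(\<Sum>\<^sub>\<infinity>j. theta_term a b j) = qpoch_inf (- a) ?P * qpoch_inf (- b) ?P * qpoch_inf ?P ?P"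
    using qpoch_inf_nonzero[OF assms assms] by (simp add: field_simps power2_eq_square)
  moreover have "theta_term a b summable_on UNIV"
    by (rule abs_summable_summable[OF summable_theta[OF assms]])
  ultimately show ?thesis by (simp add: has_sum_iff)
qed

section \<open>Generating functions of coloured partitions\<close>

text \<open>This is \<open>e ^ z\<close> when \<open>e * e = 1\<close>, available also for negative
  \<open>z\<close>, since core indices run over all integers.\<close>

definition parity_power :: "'a::comm_ring_1 \<Rightarrow> int \<Rightarrow> 'a" where
  "parity_power e z = (if even z then 1 else e)"

lemma parity_power_add:
  "e * e = 1 \<Longrightarrow> parity_power e (y + z) = parity_power e y * parity_power e z"
  by (auto simp: parity_power_def)

lemma power_eq_parity_power: "e * e = 1 \<Longrightarrow> e ^ n = parity_power e (int n)"
  by (induction n) (auto simp: parity_power_def)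

text \<open>The triangular number \<^term>\<open>tri d\<close> is the size of the 2-core of index \<open>d\<close>, and its number
  of black cells is even if its corner cell is white, and has the parity of \<open>d div 2\<close> otherwise.\<close>

definition core_term :: "'a::field \<Rightarrow> bool \<Rightarrow> 'a \<Rightarrow> int \<Rightarrow> 'a" where
  "core_term e b q d = parity_power e (if b then 0 else d div 2) * q ^ tri d"

text \<open>The reflection preserves \<open>tri\<close>, and (1 - d) div 2 is the negative of d div
  2, so the parity of black cells is preserved too.\<close>

lemma core_term_flip: "core_term e b q (1 - d) = core_term e b q d"
proof -
  have "even ((1 - d) div 2) \<longleftrightarrow> even (d div 2)" by presburger
  then show ?thesis by (simp add: core_term_def parity_power_def tri_flip)
qed

text \<open>With l = N - k the core index is k - l.\<close>

definition core_sum :: "'a::field \<Rightarrow> bool \<Rightarrow> 'a \<Rightarrow> nat \<Rightarrow> 'a" where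
  "core_sum e b q N = qconv (e * q\<^sup>2) (\<lambda>k. core_term e b q (2 * int k - int N)) N"

lemma core_sum_0: "core_sum e b q 0 = 1"
proof -
  have "core_term e b q 0 = 1" by (simp add: core_term_def parity_power_def tri_def)
  then show ?thesis by (simp add: core_sum_def qconv_def inv_qpoch_def)
qed

text \<open>The recurrence satisfied by the generating functions of partitions with parts at most \<open>N\<close>,
  which arises by removing the largest part. Here it comes from \<open>R\<^sub>l\<^sub>-\<^sub>1 = (1 - P\<^sup>l) R\<^sub>l\<close> for
  \<open>R = inv_qpoch P\<close>, followed by the reflection \<open>d \<mapsto> 1 - d\<close>, under which the terms are invariant.\<close>

lemma core_sum_Suc:
  fixes e q :: "'a::field"
  assumes e: "e * e = 1" and nz: "\<And>n. (e * q\<^sup>2) ^ Suc n \<noteq> 1"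
  shows "core_sum e b q (Suc N) = core_sum e b q N +
    e ^ (if b then Suc N div 2 else (Suc N + 1) div 2) * q ^ Suc N * core_sum e (\<not> b) q (Suc N)"
proof -
  let ?P = "e * q\<^sup>2"
  let ?c = "e ^ (if b then Suc N div 2 else (Suc N + 1) div 2) * q ^ Suc N"
  define W where "W k = core_term e b q (2 * int k - int N)" for k
  have "core_sum e b q N = qconv ?P (\<lambda>k. W k * (1 - ?P ^ (Suc N - k))) (Suc N)"
    unfolding core_sum_def W_def by (rule qconv_reduce_right[OF nz, symmetric])
  also have "\<dots> = qconv ?P (\<lambda>k. W k - W k * ?P ^ (Suc N - k)) (Suc N)"
    by (simp add: algebra_simps)
  also have "\<dots> = qconv ?P W (Suc N) - qconv ?P (\<lambda>k. W k * ?P ^ (Suc N - k)) (Suc N)"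
    by (rule qconv_diff)
  also have "qconv ?P W (Suc N) = core_sum e b q (Suc N)"
    unfolding core_sum_def
  proof (subst qconv_rev [symmetric], rule qconv_cong)
    fix k assume "k \<le> Suc N"
    then have "2 * int (Suc N - k) - int N = 1 - (2 * int k - int (Suc N))" by simp
    then show "W (Suc N - k) = core_term e b q (2 * int k - int (Suc N))"
      unfolding W_def by (simp only: core_term_flip)
  qed
  \<comment> \<open>Multiplication by \<open>?P ^ l\<close> turns the term of index d + 1 into
    \<open>?c\<close> times the oppositely coloured term of index d. The relation N + 1 = d + 2 l
    balances the powers of \<open>q\<close> and the parities of the powers of
    \<open>e\<close>.\<close>
  also have "qconv ?P (\<lambda>k. W k * ?P ^ (Suc N - k)) (Suc N) = ?c * core_sum e (\<not> b) q (Suc N)"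
    unfolding core_sum_def qconv_cmult [symmetric]
  proof (rule qconv_cong)
    fix k assume k: "k \<le> Suc N"
    define l d where "l = Suc N - k" and "d = 2 * int k - int (Suc N)"
    have N: "int (Suc N) = d + 2 * int l" and W: "W k = core_term e b q (d + 1)"
      using k by (auto simp: l_def d_def W_def algebra_simps)
    have "tri (d + 1) + 2 * l = tri d + Suc N"
      using int_tri_Suc[of d] N by simp
    then have 1: "q ^ tri (d + 1) * (q\<^sup>2) ^ l = q ^ tri d * q ^ Suc N"
      by (simp flip: power_add power_mult del: power_Suc)
    define c where "c = (if b then Suc N div 2 else (Suc N + 1) div 2)"
    have c: "int c = (if b then d div 2 else (d + 1) div 2) + int l"
      using N unfolding c_def by (cases b; simp only: if_True if_False; presburger)
    have 2: "parity_power e (if b then 0 else (d + 1) div 2) * e ^ l =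
      e ^ c * parity_power e (if \<not> b then 0 else d div 2)"
      unfolding power_eq_parity_power[OF e] parity_power_add[OF e, symmetric] c
      by (cases b) (simp_all add: parity_power_def)
    have "W k * ?P ^ l = (parity_power e (if b then 0 else (d + 1) div 2) * e ^ l) * (q ^ tri (d + 1) * (q\<^sup>2) ^ l)"
      unfolding W core_term_def by (simp only: power_mult_distrib mult_ac)
    also have "\<dots> = ?c * core_term e (\<not> b) q d"
      unfolding 1 2 core_term_def c_def by (simp only: mult_ac)
    finally show "W k * ?P ^ (Suc N - k) = ?c * core_term e (\<not> b) q (2 * int k - int (Suc N))"
      by (simp only: l_def d_def)
  qed
  finally show ?thesis by (simp add: algebra_simps)
qed

section \<open>Convergence and identification of the generating functions\<close>

lemma summable_partitions:
  assumes "0 \<le> r" "r < (1::real)"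
  shows "summable (\<lambda>n. real (card (partitions_of n)) * r ^ n)"
proof -
  define p where "p N n = real (card (partitions_bounded N n))" for N n
  have p_Suc: "p (Suc N) n = p N n + (if Suc N \<le> n then p (Suc N) (n - Suc N) else 0)" for N n
    using coloured_count_Suc[of "1::real" True N n] by (simp add: coloured_count_1 p_def)
  \<comment> \<open>Removing a largest part bounds the new partial sum by the old bound plus
    \<open>r ^ Suc N\<close> times itself; solving for it yields the next factor of
    \<open>inv_qpoch\<close>.\<close>
  have partial: "(\<Sum>n<K. p N n * r ^ n) \<le> inv_qpoch r N" for N K
  proof (induction N)
    case 0
    have "(\<Sum>n<K. p 0 n * r ^ n) = (\<Sum>n<K. if n = 0 then 1 else 0)"
      by (intro sum.cong) (auto simp: p_def partitions_bounded_0)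
    then show ?case by (simp add: inv_qpoch_def)
  next
    case (Suc N)
    let ?S = "\<Sum>n<K. p (Suc N) n * r ^ n"
    have "(\<Sum>n<K. (if Suc N \<le> n then p (Suc N) (n - Suc N) else 0) * r ^ n) =
      (\<Sum>n | n < K \<and> Suc N \<le> n. p (Suc N) (n - Suc N) * r ^ n)"
      by (intro sum.mono_neutral_cong_right) auto
    also have "\<dots> = (\<Sum>n | n + Suc N < K. p (Suc N) n * r ^ (n + Suc N))"
      by (rule sum.reindex_bij_witness[of _ "\<lambda>n. n + Suc N" "\<lambda>n. n - Suc N"]) auto
    also have "\<dots> \<le> (\<Sum>n<K. p (Suc N) n * r ^ (n + Suc N))"
      using assms by (intro sum_mono2) (auto simp: p_def)
    also have "\<dots> = r ^ Suc N * ?S"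
      by (simp add: sum_distrib_left power_add mult_ac)
    finally have "?S \<le> inv_qpoch r N + r ^ Suc N * ?S"
      using Suc.IH by (subst p_Suc) (simp add: ring_distribs sum.distrib)
    moreover have "r ^ Suc N < 1" using power_Suc_le_self[of r N] assms by linarith
    ultimately have "?S \<le> inv_qpoch r N / (1 - r ^ Suc N)"
      by (simp add: pos_le_divide_eq algebra_simps)
    also have "\<dots> = inv_qpoch r (Suc N)"
      by (simp add: inv_qpoch_def divide_inverse)
    finally show ?case .
  qed
  obtain C where C: "\<And>n. inv_qpoch r n \<le> C" using inv_qpoch_real_bounded[OF assms] by blast
  show ?thesis
  proof (rule summableI_nonneg_bounded)
    fix K
    \<comment> \<open>For n < K no partition of n has a part exceeding K.\<close>
    have "(\<Sum>n<K. real (card (partitions_of n)) * r ^ n) = (\<Sum>n<K. p K n * r ^ n)"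
      by (intro sum.cong) (auto simp: p_def partitions_bounded_eq)
    then show "(\<Sum>n<K. real (card (partitions_of n)) * r ^ n) \<le> C"
      using partial[of K K] C[of K] by linarith
  qed (use assms in auto)
qed

lemma norm_coloured_count_le:
  assumes "norm (e::complex) = 1"
  shows "norm (coloured_count e b N n) \<le> real (card (partitions_of n))"
proof -
  have "norm (coloured_count e b N n) \<le> (\<Sum>xs\<in>partitions_bounded N n. norm (e ^ black_cells b xs))"
    unfolding coloured_count_def by (rule norm_sum)
  also have "\<dots> = real (card (partitions_bounded N n))"
    using assms by (simp add: norm_power)
  also have "\<dots> \<le> real (card (partitions_of n))"
    by (intro of_nat_mono card_mono) (auto simp: partitions_bounded_def)
  finally show ?thesis .
qed

lemma summable_coloured_count:
  assumes "norm (e::complex) = 1" "norm q < 1"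
  shows "summable (\<lambda>n. coloured_count e b N n * q ^ n)"
    "summable (\<lambda>n. norm (coloured_count e b n n * q ^ n))"
proof -
  have s: "summable (\<lambda>n. real (card (partitions_of n)) * norm q ^ n)"
    using assms by (intro summable_partitions) auto
  show "summable (\<lambda>n. coloured_count e b N n * q ^ n)"
    by (rule summable_comparison_test'[OF s, of 0])
      (auto simp: norm_mult norm_power intro!: mult_right_mono norm_coloured_count_le assms)
  show "summable (\<lambda>n. norm (coloured_count e b n n * q ^ n))"
    by (rule summable_comparison_test'[OF s, of 0])
      (auto simp: norm_mult norm_power intro!: mult_right_mono norm_coloured_count_le assms)
qed

lemma suminf_coloured_count_Suc:
  fixes e q :: complex
  assumes "norm e = 1" "norm q < 1"
  shows "(\<Sum>n. coloured_count e b (Suc N) n * q ^ n) = (\<Sum>n. coloured_count e b N n * q ^ n) +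
    e ^ (if b then Suc N div 2 else (Suc N + 1) div 2) * q ^ Suc N *
      (\<Sum>n. coloured_count e (\<not> b) (Suc N) n * q ^ n)"
proof -
  let ?c = "e ^ (if b then Suc N div 2 else (Suc N + 1) div 2)"
  let ?f = "\<lambda>n. coloured_count e (\<not> b) (Suc N) n * q ^ n"
  define g where "g n = (if Suc N \<le> n then ?c * coloured_count e (\<not> b) (Suc N) (n - Suc N) * q ^ n else 0)" for n
  have "(\<lambda>n. ?c * q ^ Suc N * ?f n) sums (?c * q ^ Suc N * suminf ?f)"
    by (intro sums_mult summable_sums summable_coloured_count assms)
  also have "(\<lambda>n. ?c * q ^ Suc N * ?f n) = (\<lambda>n. g (n + Suc N))"
    by (auto simp: g_def power_add mult_ac)
  finally have "g sums (?c * q ^ Suc N * suminf ?f)"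
    by (subst (asm) sums_zero_iff_shift) (auto simp: g_def)
  then have "(\<lambda>n. coloured_count e b N n * q ^ n + g n) sums
    ((\<Sum>n. coloured_count e b N n * q ^ n) + ?c * q ^ Suc N * suminf ?f)"
    by (intro sums_add summable_sums summable_coloured_count assms)
  also have "(\<lambda>n. coloured_count e b N n * q ^ n + g n) = (\<lambda>n. coloured_count e b (Suc N) n * q ^ n)"
    by (rule ext, subst coloured_count_Suc) (auto simp: g_def ring_distribs)
  finally show ?thesis by (rule sums_unique [symmetric])
qed

text \<open>Both sides obey one recurrence, which links the two colourings at \<open>Suc N\<close>.
  The differences \<open>D\<close> thus satisfy \<open>D b = c b * D (\<not> b)\<close>; applying
  this twice gives \<open>D b\<close> a multiplier (e q^2)^(N+1), which is not 1, and forces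
  \<open>D b = 0\<close>.\<close>

lemma suminf_coloured_count_eq_core_sum:
  fixes e q :: complex
  assumes e: "e * e = 1" and q: "norm q < 1"
  shows "(\<Sum>n. coloured_count e b N n * q ^ n) = core_sum e b q N"
proof (induction N arbitrary: b)
  case 0
  have "(\<lambda>n. coloured_count e b 0 n * q ^ n) = (\<lambda>n. if n = 0 then 1 else 0)"
    by (auto simp: coloured_count_0)
  then show ?case using sums_single[of 0 "\<lambda>_. 1::complex"] by (simp add: core_sum_0 sums_iff)
next
  case (Suc N)
  have ne: "norm e = 1"
    using e by (auto simp: square_eq_1_iff)
  have P: "norm (e * q\<^sup>2) < 1"
    using ne q by (simp add: norm_mult norm_power power_less_one_iff abs_square_less_1)
  define D where "D b = (\<Sum>n. coloured_count e b (Suc N) n * q ^ n) - core_sum e b q (Suc N)" for b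
  define c where "c b = e ^ (if b then Suc N div 2 else (Suc N + 1) div 2) * q ^ Suc N" for b
  have D: "D b = c b * D (\<not> b)" for b
    unfolding D_def c_def
    by (subst suminf_coloured_count_Suc[OF ne q], subst core_sum_Suc[OF e power_Suc_neq_1[OF P]])
      (simp add: Suc.IH right_diff_distrib)
  have "c True * c False = e ^ (Suc N div 2 + (Suc N + 1) div 2) * (q\<^sup>2) ^ Suc N"
    by (simp only: c_def power_add power2_eq_square power_mult_distrib if_True if_False mult_ac)
  \<comment> \<open>Each cell of a row of length \<open>Suc N\<close> is black in exactly one of the
    two colourings.\<close>
  also have "Suc N div 2 + (Suc N + 1) div 2 = Suc N" by presburger
  finally have cc: "c True * c False = (e * q\<^sup>2) ^ Suc N" by (simp only: power_mult_distrib)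
  have "D b = c b * c (\<not> b) * D b" using D[of b] D[of "\<not> b"] by simp
  moreover have "c b * c (\<not> b) \<noteq> 1"
    using cc power_Suc_neq_1[OF P, of N] by (cases b) (simp_all add: mult.commute del: power_Suc)
  ultimately have "D b = 0" by auto
  then show ?case by (simp add: D_def)
qed

text \<open>Let the bound on the parts tend to infinity through even values 2 m. The core indices
  are then 2 (k - m), which yields the theta series; the coefficients are eventually constant and
  dominated by partition numbers.\<close>

lemma coloured_count_generating_function:
  fixes e q :: complex
  assumes e: "e * e = 1" and q: "norm q < 1"
  shows "(\<lambda>n. coloured_count e True n n * q ^ n) sums
    ((\<Sum>\<^sub>\<infinity>j. theta_term q (q ^ 3) j) / qpoch_inf (e * q\<^sup>2) (e * q\<^sup>2) ^ 2)"
proof -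
  have ne: "norm e = 1"
    using e by (auto simp: square_eq_1_iff)
  have P: "norm (e * q\<^sup>2) < 1"
    using ne q by (simp add: norm_mult norm_power power_less_one_iff abs_square_less_1)
  define f where "f m n = coloured_count e True (2 * m) n * q ^ n" for m n
  have infsum_eq: "infsum g UNIV = suminf g" if "summable (\<lambda>n. norm (g n))" for g :: "nat \<Rightarrow> complex"
    using norm_summable_imp_has_sum[OF that summable_sums[OF summable_norm_cancel[OF that]]]
    by (rule infsumI)
  have s: "summable (\<lambda>n. real (card (partitions_of n)) * norm q ^ n)"
    using q by (intro summable_partitions) auto
  have f_le: "norm (f m n) \<le> real (card (partitions_of n)) * norm q ^ n" for m n
    by (auto simp: f_def norm_mult norm_power intro!: mult_right_mono norm_coloured_count_le ne)
  have "(\<lambda>m. \<Sum>\<^sub>\<infinity>n. f m n) \<longlonglongrightarrow> (\<Sum>\<^sub>\<infinity>n. coloured_count e True n n * q ^ n)"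
  proof (rule tannery[OF f_le])
    show "(\<lambda>n. real (card (partitions_of n)) * norm q ^ n) summable_on UNIV"
      by (rule summable_nonneg_imp_summable_on[OF s]) simp
    show "(\<lambda>m. f m n) \<longlonglongrightarrow> coloured_count e True n n * q ^ n" for n
    proof (rule tendsto_eventually)
      show "\<forall>\<^sub>F m in sequentially. f m n = coloured_count e True n n * q ^ n"
        using eventually_ge_at_top[of n]
        unfolding f_def by eventually_elim (subst coloured_count_stable, simp_all)
    qed
  qed
  moreover have "(\<Sum>\<^sub>\<infinity>n. f m n) = core_sum e True q (2 * m)" for m
  proof -
    have "summable (\<lambda>n. norm (f m n))"
      by (rule summable_comparison_test'[OF s, of 0]) (simp only: real_norm_def abs_norm_cancel f_le)
    from infsum_eq[OF this] show ?thesis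
      by (simp only: f_def suminf_coloured_count_eq_core_sum[OF e q])
  qed
  moreover have "core_sum e True q (2 * m) = qconv (e * q\<^sup>2) (\<lambda>k. theta_term q (q ^ 3) (int k - int m)) (2 * m)" for m
  proof -
    have "core_term e True q (2 * j) = theta_term q (q ^ 3) j" for j
      by (simp add: core_term_def theta_term_cube parity_power_def)
    moreover have "2 * int k - int (2 * m) = 2 * (int k - int m)" for k by simp
    ultimately show ?thesis by (simp only: core_sum_def)
  qed
  moreover have "(\<lambda>m. qconv (e * q\<^sup>2) (\<lambda>k. theta_term q (q ^ 3) (int k - int m)) (2 * m)) \<longlonglongrightarrow>
     (\<Sum>\<^sub>\<infinity>j. theta_term q (q ^ 3) j) / qpoch_inf (e * q\<^sup>2) (e * q\<^sup>2) ^ 2"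
  proof (intro qconv_LIMSEQ P summable_theta)
    have "norm (q * q ^ 3) = norm q ^ 4" by (simp flip: power_Suc norm_power)
    then show "norm (q * q ^ 3) < 1" using q by (simp add: power_less_one_iff)
  qed
  ultimately have "(\<Sum>\<^sub>\<infinity>n. coloured_count e True n n * q ^ n) =
     (\<Sum>\<^sub>\<infinity>j. theta_term q (q ^ 3) j) / qpoch_inf (e * q\<^sup>2) (e * q\<^sup>2) ^ 2"
    by (simp only:) (rule LIMSEQ_unique)
  moreover note s' = summable_coloured_count(2)[OF ne q, of True]
  ultimately show ?thesis
    using infsum_eq[OF s'] summable_sums[OF summable_norm_cancel[OF s']] by simp
qed

lemma of_int_coloured_count:
  "of_int (coloured_count e b N n) = (coloured_count (of_int e) b N n :: 'a::comm_ring_1)"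
  by (simp add: coloured_count_def)

lemma of_int_u_num:
  "(of_int (u_num n) :: 'a::field_char_0) = (coloured_count 1 True n n - coloured_count (-1) True n n) / 2"
proof -
  have "(of_int (2 * u_num n) :: 'a) = of_int (coloured_count 1 True n n - coloured_count (-1) True n n)"
    by (simp only: u_num_coloured_count)
  then show ?thesis by (simp add: of_int_coloured_count field_simps)
qed

lemma u_num_generating_function:
  fixes q :: complex
  assumes q: "norm q < 1"
  shows "(\<lambda>n. of_int (u_num n) * q ^ n) sums
    ((\<Sum>\<^sub>\<infinity>j. theta_term q (q ^ 3) j) *
      (1 / qpoch_inf (q\<^sup>2) (q\<^sup>2) ^ 2 - 1 / qpoch_inf (- (q\<^sup>2)) (- (q\<^sup>2)) ^ 2) / 2)"
proof -
  let ?T = "\<Sum>\<^sub>\<infinity>j. theta_term q (q ^ 3) j"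
  have "(\<lambda>n. (coloured_count 1 True n n * q ^ n - coloured_count (-1) True n n * q ^ n) / 2) sums
    ((?T / qpoch_inf (q\<^sup>2) (q\<^sup>2) ^ 2 - ?T / qpoch_inf (- (q\<^sup>2)) (- (q\<^sup>2)) ^ 2) / 2)"
    using coloured_count_generating_function[of 1 q] coloured_count_generating_function[of "-1" q] q
    by (intro sums_divide sums_diff) auto
  then show ?thesis by (simp add: of_int_u_num algebra_simps)
qed

section \<open>Dissection modulo 4\<close>

lemma qpoch_inf_split:
  assumes "norm q < 1"
  shows "qpoch_inf a q = qpoch_inf a (q\<^sup>2) * qpoch_inf (a * q) (q\<^sup>2)"
proof (rule LIMSEQ_unique)
  have q2: "norm (q\<^sup>2) < 1" using assms by (simp add: norm_power power_less_one_iff)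
  have "filterlim (\<lambda>n::nat. 2 * n) sequentially sequentially"
    by (simp add: filterlim_subseq strict_mono_def)
  from filterlim_compose[OF qpoch_inf_LIMSEQ[OF assms] this]
  show "(\<lambda>n. \<Prod>k<2 * n. 1 - a * q ^ k) \<longlonglongrightarrow> qpoch_inf a q" .
  have "(\<Prod>k<2 * n. 1 - a * q ^ k) = (\<Prod>k<n. 1 - a * (q\<^sup>2) ^ k) * (\<Prod>k<n. 1 - a * q * (q\<^sup>2) ^ k)" for n
    by (induction n) (simp_all add: power_mult [symmetric] mult_ac)
  then show "(\<lambda>n. \<Prod>k<2 * n. 1 - a * q ^ k) \<longlonglongrightarrow> qpoch_inf a (q\<^sup>2) * qpoch_inf (a * q) (q\<^sup>2)"
    using tendsto_mult[OF qpoch_inf_LIMSEQ[OF q2, of a] qpoch_inf_LIMSEQ[OF q2, of "a * q"]] by simp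
qed

lemma qpoch_inf_mult_uminus:
  assumes "norm q < 1"
  shows "qpoch_inf a q * qpoch_inf (- a) q = qpoch_inf (a\<^sup>2) (q\<^sup>2)"
proof (rule LIMSEQ_unique)
  have q2: "norm (q\<^sup>2) < 1" using assms by (simp add: norm_power power_less_one_iff)
  show "(\<lambda>n. \<Prod>k<n. 1 - a\<^sup>2 * (q\<^sup>2) ^ k) \<longlonglongrightarrow> qpoch_inf (a\<^sup>2) (q\<^sup>2)"
    by (rule qpoch_inf_LIMSEQ[OF q2])
  have "(1 - a * q ^ k) * (1 - - a * q ^ k) = 1 - a\<^sup>2 * (q\<^sup>2) ^ k" for k
    by (simp add: power2_eq_square power_mult_distrib algebra_simps)
  then show "(\<lambda>n. \<Prod>k<n. 1 - a\<^sup>2 * (q\<^sup>2) ^ k) \<longlonglongrightarrow> qpoch_inf a q * qpoch_inf (- a) q"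
    using tendsto_mult[OF qpoch_inf_LIMSEQ[OF assms, of a] qpoch_inf_LIMSEQ[OF assms, of "- a"]]
    by (simp only: prod.distrib [symmetric])
qed

lemma qpoch_inf_minus_one:
  assumes "norm q < 1"
  shows "qpoch_inf (- 1) q = 2 * qpoch_inf (- q) q"
proof (rule LIMSEQ_unique)
  show "(\<lambda>n. \<Prod>k<Suc n. 1 - (- 1) * q ^ k) \<longlonglongrightarrow> qpoch_inf (- 1) q"
    by (rule LIMSEQ_Suc[OF qpoch_inf_LIMSEQ[OF assms]])
  have "(\<Prod>k<Suc n. 1 - (- 1) * q ^ k) = 2 * (\<Prod>k<n. 1 - (- q) * q ^ k)" for n
    by (subst prod.lessThan_Suc_shift) simp
  then show "(\<lambda>n. \<Prod>k<Suc n. 1 - (- 1) * q ^ k) \<longlonglongrightarrow> 2 * qpoch_inf (- q) q"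
    by (simp only:) (intro tendsto_intros qpoch_inf_LIMSEQ assms)
qed

text \<open>By the triple product both squares come from theta series with terms x^(j^2) and
  (-x)^(j^2). Even \<open>j\<close> cancel and odd ones double; j = 2 i + 1 gives j^2 = 1 + 8 T(i +
  1), a theta series with parameters \<open>x ^ 8\<close> and 1. The second factor 2 is the first
  factor of (-1; x^8).\<close>

lemma theta_odd_part:
  fixes x :: complex
  assumes "norm x < 1"
  shows "qpoch_inf (x\<^sup>2) (x\<^sup>2) * ((qpoch_inf (- x) (x\<^sup>2))\<^sup>2 - (qpoch_inf x (x\<^sup>2))\<^sup>2) =
    4 * x * (qpoch_inf (- (x ^ 8)) (x ^ 8))\<^sup>2 * qpoch_inf (x ^ 8) (x ^ 8)"
proof -
  have n: "norm (x ^ 8) < 1" "norm (x * x) < 1"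
    using assms by (simp_all add: norm_power power_less_one_iff flip: power2_eq_square)
  let ?J = "\<lambda>i. theta_term (x ^ 8) 1 i"
  have diff: "theta_term x x j - theta_term (- x) (- x) j = (if even j then 0 else 2 * x ^ (tri (j + 1) + tri j))" for j
  proof -
    have "even (tri (j + 1) + tri j) \<longleftrightarrow> even j"
      using int_tri_Suc[of j] by presburger
    then show ?thesis
      by (auto simp: theta_term_def power_add [symmetric])
  qed
  have "((\<lambda>j. theta_term x x j - theta_term (- x) (- x) j) has_sum
    (qpoch_inf (- x) (x * x) * qpoch_inf (- x) (x * x) * qpoch_inf (x * x) (x * x) -
     qpoch_inf x (x * x) * qpoch_inf x (x * x) * qpoch_inf (x * x) (x * x))) UNIV"
    using has_sum_add[OF jacobi_triple[of x x] has_sum_uminusI[OF jacobi_triple[of "- x" "- x"]]] n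
    by (simp add: mult_ac)
  also have "?this \<longleftrightarrow> ((\<lambda>j. 2 * x ^ (tri (j + 1) + tri j)) has_sum
    (qpoch_inf (- x) (x * x) * qpoch_inf (- x) (x * x) * qpoch_inf (x * x) (x * x) -
     qpoch_inf x (x * x) * qpoch_inf x (x * x) * qpoch_inf (x * x) (x * x))) {j. odd j}"
    by (rule has_sum_cong_neutral) (auto simp: diff)
  also have "\<dots> \<longleftrightarrow> ((\<lambda>i. 2 * x * ?J i) has_sum
    (qpoch_inf (- x) (x * x) * qpoch_inf (- x) (x * x) * qpoch_inf (x * x) (x * x) -
     qpoch_inf x (x * x) * qpoch_inf x (x * x) * qpoch_inf (x * x) (x * x))) UNIV"
  proof (rule has_sum_reindex_bij_witness[of _ "\<lambda>i. 2 * i + 1" "\<lambda>j. j div 2"])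
    fix j :: int assume "j \<in> {j. odd j}"
    then have "j = 2 * (j div 2) + 1" by simp
    moreover define i where "i = j div 2"
    ultimately have j: "j = 2 * i + 1" by simp
    have "int (tri (j + 1) + tri j) = int (1 + 8 * tri (i + 1))"
      using two_int_tri[of "j + 1"] two_int_tri[of j] two_int_tri[of "i + 1"]
      by (simp add: j algebra_simps)
    then have "tri (j + 1) + tri j = 1 + 8 * tri (i + 1)" by (simp only: of_nat_eq_iff)
    then show "2 * x * ?J (j div 2) = 2 * x ^ (tri (j + 1) + tri j)"
      by (simp only: i_def [symmetric]) (simp add: theta_term_def power_mult)
  qed auto
  finally have 1: "((\<lambda>i. 2 * x * ?J i) has_sum
    (qpoch_inf (- x) (x * x) * qpoch_inf (- x) (x * x) * qpoch_inf (x * x) (x * x) -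
     qpoch_inf x (x * x) * qpoch_inf x (x * x) * qpoch_inf (x * x) (x * x))) UNIV" .
  have 2: "((\<lambda>i. 2 * x * ?J i) has_sum
    (2 * x * (qpoch_inf (- (x ^ 8)) (x ^ 8) * qpoch_inf (- 1) (x ^ 8) * qpoch_inf (x ^ 8) (x ^ 8)))) UNIV"
    using jacobi_triple[of "x ^ 8" 1] n by (intro has_sum_cmult_right) simp
  from has_sum_unique[OF 1 2] show ?thesis
    by (simp add: qpoch_inf_minus_one n power2_eq_square algebra_simps)
qed

text \<open>Separating even and odd powers gives (x; x) = A E, (-x; -x) = B E and E = A B F. The
  difference of the inverse squares then has B^2 - A^2 in its numerator, which
  \<open>theta_odd_part\<close> evaluates.\<close>

lemma qpoch_difference_eq_V_fun:
  fixes x :: complex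
  assumes x: "norm x < 1"
  shows "1 / (qpoch_inf x x)\<^sup>2 - 1 / (qpoch_inf (- x) (- x))\<^sup>2 = 4 * x * V_fun (x\<^sup>2)"
proof -
  have n: "norm (x\<^sup>2) < 1" "norm (x ^ 4) < 1" "norm (x ^ 8) < 1"
    using x by (simp_all add: norm_power power_less_one_iff)
  define A B E F G H K where
    "A = qpoch_inf x (x\<^sup>2)" and "B = qpoch_inf (- x) (x\<^sup>2)" and "E = qpoch_inf (x\<^sup>2) (x\<^sup>2)" and
    "F = qpoch_inf (x ^ 4) (x ^ 4)" and "G = qpoch_inf (- (x ^ 8)) (x ^ 8)" and
    "H = qpoch_inf (x ^ 16) (x ^ 16)" and "K = qpoch_inf (x ^ 8) (x ^ 8)"
  note defs = A_def B_def E_def F_def G_def H_def K_def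
  have nz: "A \<noteq> 0" "B \<noteq> 0" "E \<noteq> 0" "F \<noteq> 0" "K \<noteq> 0"
    unfolding defs by (rule qpoch_inf_nonzero; simp only: norm_minus_cancel x n)+
  have AE: "qpoch_inf x x = A * E" and BE: "qpoch_inf (- x) (- x) = B * E"
    using qpoch_inf_split[OF x, of x] qpoch_inf_split[of "- x" "- x"] x
    by (simp_all add: defs power2_eq_square)
  have "E = A * B * F"
    using qpoch_inf_split[OF n(1), of "x\<^sup>2"] qpoch_inf_mult_uminus[OF n(1), of x]
    by (simp add: defs flip: power_mult power_add)
  moreover have "H = K * G"
    using qpoch_inf_mult_uminus[OF n(3), of "x ^ 8"] by (simp add: defs flip: power_mult)
  moreover have "E * (B\<^sup>2 - A\<^sup>2) = 4 * x * G\<^sup>2 * K"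
    using theta_odd_part[OF x] by (simp add: defs)
  moreover have "V_fun (x\<^sup>2) = F\<^sup>2 * H\<^sup>2 / (E ^ 5 * K)"
    by (simp add: V_fun_def defs flip: power_mult)
  \<comment> \<open>Expanding by E F^2 makes both E (B^2 - A^2) and A B F = E available for
    substitution.\<close>
  moreover have "1 / (A * E)\<^sup>2 - 1 / (B * E)\<^sup>2 = E * (B\<^sup>2 - A\<^sup>2) * F\<^sup>2 / (E * (A * B * F)\<^sup>2 * E\<^sup>2)"
    using nz by (simp add: field_simps)
  ultimately have "1 / (A * E)\<^sup>2 - 1 / (B * E)\<^sup>2 = 4 * x * G\<^sup>2 * K * F\<^sup>2 / (E * E\<^sup>2 * E\<^sup>2)"
    "V_fun (x\<^sup>2) = F\<^sup>2 * (K * G)\<^sup>2 / (E ^ 5 * K)" by simp_all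
  moreover have "F\<^sup>2 * (K * G)\<^sup>2 / (E ^ 5 * K) = F\<^sup>2 * G\<^sup>2 * K / E ^ 5"
    using nz by (simp add: power2_eq_square)
  moreover have "E * E\<^sup>2 * E\<^sup>2 = E ^ 5" by (simp add: eval_nat_numeral)
  ultimately show ?thesis unfolding AE BE by (simp add: mult_ac)
qed

section \<open>Extraction of residue classes by fourth roots of unity\<close>

lemma fourth_root_filter:
  "(\<Sum>k<4. (- \<i>) ^ (k * r) * (\<i> ^ k) ^ n) = (if n mod 4 = r mod 4 then 4 else 0)"
proof -
  have m: "z ^ n = z ^ (n mod 4)" if "z ^ 4 = 1" for z :: complex and n
  proof -
    have "z ^ n = (z ^ 4) ^ (n div 4) * z ^ (n mod 4)"
      by (simp flip: power_mult power_add)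
    then show ?thesis by (simp add: that)
  qed
  \<comment> \<open>Here z is \<open>\<i>\<close> to the power n - r, so the filter is 1 + z + z^2 +
    z^3. Reduced exponents leave sixteen cases to check.\<close>
  define z where "z = (- \<i>) ^ (r mod 4) * \<i> ^ (n mod 4)"
  have z: "(- \<i>) ^ r * \<i> ^ n = z"
    unfolding z_def by (subst m[of "- \<i>"], simp, subst m[of "\<i>"]) simp_all
  have "(- \<i>) ^ (k * r) * (\<i> ^ k) ^ n = z ^ k" for k
    unfolding z [symmetric] by (simp add: power_mult_distrib mult.commute flip: power_mult)
  then have sum: "(\<Sum>k<4. (- \<i>) ^ (k * r) * (\<i> ^ k) ^ n) = 1 + z + z\<^sup>2 + z ^ 3"
    by (simp add: numeral_eq_Suc)
  define s t where "s = n mod 4" and "t = r mod 4"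
  have "s \<in> {0, 1, 2, 3}" "t \<in> {0, 1, 2, 3}" by (auto simp: s_def t_def)
  then have "1 + z + z\<^sup>2 + z ^ 3 = (if s = t then 4 else 0)"
    unfolding z_def s_def [symmetric] t_def [symmetric]
    by (auto simp: power2_eq_square power3_eq_cube)
  then show ?thesis unfolding sum s_def t_def .
qed

lemma has_sum_sum_lessThan:
  fixes f :: "nat \<Rightarrow> 'i \<Rightarrow> 'b::topological_comm_monoid_add"
  assumes "\<And>k. (f k has_sum F k) A"
  shows "((\<lambda>x. \<Sum>k<n. f k x) has_sum (\<Sum>k<n. F k)) A"
proof (induction n)
  case (Suc n)
  then show ?case using has_sum_add[OF Suc.IH assms[of n]] by simp
qed simp

text \<open>Averaging the values at the four rotations of \<open>q\<close>, with weights
  \<open>(- \<i>) ^ (k * r)\<close>, keeps only exponents congruent to \<open>r\<close> modulo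
  4.\<close>

lemma has_sum_section:
  fixes c :: "'i \<Rightarrow> complex" and e :: "'i \<Rightarrow> nat"
  assumes "\<And>k. ((\<lambda>x. c x * (\<i> ^ k * q) ^ e x) has_sum F k) UNIV"
  shows "((\<lambda>x. c x * q ^ e x) has_sum (\<Sum>k<4. (- \<i>) ^ (k * r) * F k) / 4) {x. e x mod 4 = r mod 4}"
proof -
  have "((\<lambda>x. (\<Sum>k<4. (- \<i>) ^ (k * r) * (c x * (\<i> ^ k * q) ^ e x)) / 4) has_sum
    (\<Sum>k<4. (- \<i>) ^ (k * r) * F k) / 4) UNIV"
    by (intro has_sum_divide_const has_sum_sum_lessThan has_sum_cmult_right assms)
  also have "(\<lambda>x. (\<Sum>k<4. (- \<i>) ^ (k * r) * (c x * (\<i> ^ k * q) ^ e x)) / 4) =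
    (\<lambda>x. if e x mod 4 = r mod 4 then c x * q ^ e x else 0)"
  proof
    fix x
    have "(\<Sum>k<4. (- \<i>) ^ (k * r) * (c x * (\<i> ^ k * q) ^ e x)) =
      c x * q ^ e x * (\<Sum>k<4. (- \<i>) ^ (k * r) * (\<i> ^ k) ^ e x)"
      unfolding sum_distrib_left by (simp add: power_mult_distrib mult_ac)
    then show "(\<Sum>k<4. (- \<i>) ^ (k * r) * (c x * (\<i> ^ k * q) ^ e x)) / 4 =
      (if e x mod 4 = r mod 4 then c x * q ^ e x else 0)"
      by (simp add: fourth_root_filter)
  qed
  finally show ?thesis
    by (rule has_sum_cong_neutral[THEN iffD1, rotated -1]) auto
qed

text \<open>Rotating \<open>q\<close> by a fourth root of unity leaves V(q^4) unchanged, so the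
  filter acts only on q^2 times the theta series. The factor q^2 shifts the class required of the
  theta exponents from r to r - 2, that is r + 2 modulo 4.\<close>

lemma u_num_section:
  assumes q: "norm q < 1"
  shows "((\<lambda>n. of_int (u_num n) * q ^ n) has_sum
    2 * q\<^sup>2 * V_fun (q ^ 4) * (\<Sum>\<^sub>\<infinity>j\<in>{j. tri (2 * j) mod 4 = (r + 2) mod 4}. q ^ tri (2 * j)))
    {n. n mod 4 = r mod 4}"
proof -
  define T where "T q = (\<Sum>\<^sub>\<infinity>j. theta_term q (q ^ 3) j)" for q :: complex
  have nq: "norm (\<i> ^ k * q) < 1" for k using q by (simp add: norm_mult norm_power)
  have T: "((\<lambda>j. 1 * (\<i> ^ k * q) ^ tri (2 * j)) has_sum T (\<i> ^ k * q)) UNIV" for k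
  proof -
    let ?q = "\<i> ^ k * q"
    have "norm (?q * ?q ^ 3) = norm ?q ^ 4" by (simp flip: power_Suc norm_power)
    then have "norm (?q * ?q ^ 3) < 1" using nq[of k] by (simp add: power_less_one_iff)
    then have "theta_term ?q (?q ^ 3) summable_on UNIV"
      by (rule abs_summable_summable[OF summable_theta])
    then show ?thesis unfolding T_def mult_1 theta_term_cube by (rule has_sum_infsum)
  qed
  have U: "((\<lambda>n. of_int (u_num n) * (\<i> ^ k * q) ^ n) has_sum
    2 * (\<i> ^ k * q)\<^sup>2 * V_fun (q ^ 4) * T (\<i> ^ k * q)) UNIV" for k
  proof -
    define w where "w = \<i> ^ k * q"
    have w: "norm w < 1" unfolding w_def by (rule nq)
    have "(\<i> ^ k) ^ 4 = (\<i> ^ 4) ^ k" by (simp only: power_mult [symmetric] mult.commute)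
    then have "w ^ 4 = q ^ 4" by (simp add: w_def power_mult_distrib)
    then have w4: "(w\<^sup>2)\<^sup>2 = q ^ 4" using power_mult[of w 2 2] by simp
    have "norm (w\<^sup>2) < 1" using w by (simp add: norm_power power_less_one_iff)
    note D = qpoch_difference_eq_V_fun[OF this, unfolded w4]
    have "(\<lambda>n. of_int (u_num n) * w ^ n) sums (T w * (4 * w\<^sup>2 * V_fun (q ^ 4)) / 2)"
      using u_num_generating_function[OF w] unfolding D T_def [symmetric] .
    then have sums: "(\<lambda>n. of_int (u_num n) * w ^ n) sums (2 * w\<^sup>2 * V_fun (q ^ 4) * T w)"
      by (simp add: mult_ac)
    have "summable (\<lambda>n. norm (of_int (u_num n) * w ^ n))"
    proof -
      have "of_int (u_num n) * w ^ n = (coloured_count 1 True n n * w ^ n - coloured_count (-1) True n n * w ^ n) / 2" for n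
        by (simp add: of_int_u_num algebra_simps)
      then have le: "norm (of_int (u_num n) * w ^ n) \<le>
        (norm (coloured_count 1 True n n * w ^ n) + norm (coloured_count (-1) True n n * w ^ n)) / 2" for n
        by (simp only: norm_divide) (simp add: norm_triangle_ineq4)
      have "summable (\<lambda>n. (norm (coloured_count 1 True n n * w ^ n) + norm (coloured_count (-1) True n n * w ^ n)) / 2)"
        using w by (intro summable_divide summable_add summable_coloured_count) auto
      from summable_comparison_test'[OF this, of 0 "\<lambda>n. norm (of_int (u_num n) * w ^ n)"]
      show ?thesis by (simp only: real_norm_def abs_norm_cancel le)
    qed
    from norm_summable_imp_has_sum[OF this sums] show ?thesis unfolding w_def .
  qed
  have "(\<Sum>k<4. (- \<i>) ^ (k * r) * (2 * (\<i> ^ k * q)\<^sup>2 * V_fun (q ^ 4) * T (\<i> ^ k * q))) / 4 =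
    2 * q\<^sup>2 * V_fun (q ^ 4) * ((\<Sum>k<4. (- \<i>) ^ (k * (r + 2)) * T (\<i> ^ k * q)) / 4)"
  proof -
    have square: "(\<i> ^ k)\<^sup>2 = (- \<i>) ^ (k * 2)" for k
    proof -
      have "(\<i> ^ k)\<^sup>2 = (\<i>\<^sup>2) ^ k" by (simp only: power_mult [symmetric] mult.commute)
      also have "\<dots> = ((- \<i>)\<^sup>2) ^ k" by simp
      also have "\<dots> = (- \<i>) ^ (k * 2)" by (simp only: power_mult [symmetric] mult.commute)
      finally show ?thesis .
    qed
    have "(- \<i>) ^ (k * r) * (2 * (\<i> ^ k * q)\<^sup>2 * V_fun (q ^ 4) * T (\<i> ^ k * q)) =
      2 * q\<^sup>2 * V_fun (q ^ 4) * ((- \<i>) ^ (k * (r + 2)) * T (\<i> ^ k * q))" for k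
      by (simp only: power_mult_distrib square distrib_left power_add mult_ac)
    then show ?thesis by (simp only: sum_distrib_left [symmetric] times_divide_eq_right)
  qed
  moreover have "(\<Sum>k<4. (- \<i>) ^ (k * (r + 2)) * T (\<i> ^ k * q)) / 4 =
    (\<Sum>\<^sub>\<infinity>j\<in>{j. tri (2 * j) mod 4 = (r + 2) mod 4}. q ^ tri (2 * j))"
    using has_sum_section[where c = "\<lambda>_. 1" and e = "\<lambda>j. tri (2 * j)", OF T, of "r + 2"]
    by (intro infsumI [symmetric]) (simp only: mult_1)
  ultimately show ?thesis
    using has_sum_section[where c = "\<lambda>n. of_int (u_num n)" and e = "\<lambda>n. n", OF U, of r]
    by (simp only:)
qed

text \<open>With q a fourth root of Q and T(2 j) congruent to j modulo 4, the selected indices are j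
  = 4 i + c. The last hypothesis makes their theta series q^s f(Q^a, Q^b), which the triple product
  evaluates; q^(s+2) = q^r Q^t then allows division by q^r.\<close>

lemma u_num_section_product:
  fixes Q :: complex and c :: int
  assumes Q: "norm Q < 1" "Q \<noteq> 0" and r: "r < 4" and rc: "int (r + 2) mod 4 = c mod 4"
    and st: "s + 2 = r + 4 * t" and ab: "a + b = 16"
    and tri: "\<And>i. tri (2 * (4 * i + c)) = s + 4 * (a * tri (i + 1) + b * tri i)"
  shows "(\<lambda>n. of_int (u_num (4 * n + r)) * Q ^ n) sums
    (2 * Q ^ t * qpoch_inf (Q ^ 16) (Q ^ 16) * qpoch_inf (- (Q ^ a)) (Q ^ 16) *
      qpoch_inf (- (Q ^ b)) (Q ^ 16) * V_fun Q)"
proof -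
  define q where "q = csqrt (csqrt Q)"
  have "(q\<^sup>2)\<^sup>2 = Q" by (simp add: q_def)
  then have q4: "q ^ 4 = Q" by (simp flip: power_mult)
  then have "norm q ^ 4 < 1" using Q by (simp flip: norm_power)
  then have q: "norm q < 1" "q \<noteq> 0" using Q q4 by (auto simp: power_less_one_iff)
  let ?J = "qpoch_inf (- (Q ^ a)) (Q ^ 16) * qpoch_inf (- (Q ^ b)) (Q ^ 16) * qpoch_inf (Q ^ 16) (Q ^ 16)"
  have "norm (Q ^ 16) < 1" using Q by (simp add: norm_power power_less_one_iff)
  then have "((\<lambda>i. q ^ s * theta_term (Q ^ a) (Q ^ b) i) has_sum q ^ s * ?J) UNIV"
    using jacobi_triple[of "Q ^ a" "Q ^ b"] ab by (intro has_sum_cmult_right) (simp flip: power_add)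
  also have "?this \<longleftrightarrow> ((\<lambda>j. q ^ tri (2 * j)) has_sum q ^ s * ?J) {j. tri (2 * j) mod 4 = (r + 2) mod 4}"
  proof (rule has_sum_reindex_bij_witness[of _ "\<lambda>j. (j - c) div 4" "\<lambda>i. 4 * i + c"])
    have *: "tri (2 * j) mod 4 = (r + 2) mod 4 \<longleftrightarrow> j mod 4 = c mod 4" for j
    proof -
      have "int (tri (2 * j)) = j + 4 * int (tri j)"
        using two_int_tri[of j] two_int_tri[of "2 * j"] by (simp add: algebra_simps)
      then have "int (tri (2 * j) mod 4) = j mod 4" by (simp add: zmod_int)
      moreover have "int ((r + 2) mod 4) = c mod 4" using rc by (simp add: zmod_int)
      ultimately show ?thesis by (simp only: of_nat_eq_iff [symmetric, where 'a = int])
    qed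
    show "4 * i + c \<in> {j. tri (2 * j) mod 4 = (r + 2) mod 4}" for i
      by (simp only: mem_Collect_eq *) simp
    show "4 * ((j - c) div 4) + c = j" if "j \<in> {j. tri (2 * j) mod 4 = (r + 2) mod 4}" for j
      using that unfolding mem_Collect_eq * by (simp add: mod_eq_dvd_iff)
    show "q ^ tri (2 * (4 * i + c)) = q ^ s * theta_term (Q ^ a) (Q ^ b) i" for i
      unfolding tri theta_term_def q4 [symmetric] power_mult [symmetric] power_add [symmetric]
      by (simp add: algebra_simps)
  qed auto
  finally have J: "(\<Sum>\<^sub>\<infinity>j\<in>{j. tri (2 * j) mod 4 = (r + 2) mod 4}. q ^ tri (2 * j)) = q ^ s * ?J"
    by (rule infsumI)
  have "((\<lambda>n. of_int (u_num n) * q ^ n) has_sum 2 * q\<^sup>2 * V_fun Q * (q ^ s * ?J)) {n. n mod 4 = r}"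
    using u_num_section[OF q(1), of r] r unfolding J q4 by simp
  also have "?this \<longleftrightarrow> ((\<lambda>n. of_int (u_num (4 * n + r)) * q ^ (4 * n + r)) has_sum 2 * q\<^sup>2 * V_fun Q * (q ^ s * ?J)) UNIV"
  proof (intro has_sum_reindex_bij_witness[of _ "\<lambda>n. 4 * n + r" "\<lambda>n. n div 4"])
    fix n assume "n \<in> {n. n mod 4 = r}"
    then have n: "4 * (n div 4) + r = n" using mult_div_mod_eq[of 4 n] by simp
    then show "4 * (n div 4) + r = n" .
    show "of_int (u_num (4 * (n div 4) + r)) * q ^ (4 * (n div 4) + r) = of_int (u_num n) * q ^ n"
      by (simp only: n)
  qed (use r in auto)
  finally have sum: "((\<lambda>n. of_int (u_num (4 * n + r)) * q ^ (4 * n + r) / q ^ r) has_sum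
    2 * q\<^sup>2 * V_fun Q * (q ^ s * ?J) / q ^ r) UNIV"
    by (rule has_sum_divide_const)
  have summand: "of_int (u_num (4 * n + r)) * q ^ (4 * n + r) / q ^ r = of_int (u_num (4 * n + r)) * Q ^ n" for n
    using q(2) by (simp add: power_add power_mult q4)
  have total: "2 * q\<^sup>2 * V_fun Q * (q ^ s * ?J) / q ^ r =
    2 * Q ^ t * qpoch_inf (Q ^ 16) (Q ^ 16) * qpoch_inf (- (Q ^ a)) (Q ^ 16) *
      qpoch_inf (- (Q ^ b)) (Q ^ 16) * V_fun Q"
  proof -
    have "q ^ s * q\<^sup>2 = q ^ r * Q ^ t"
      unfolding q4 [symmetric] power_mult [symmetric] power_add [symmetric] st ..
    moreover have "2 * q\<^sup>2 * V_fun Q * (q ^ s * ?J) = (q ^ s * q\<^sup>2) * (2 * V_fun Q * ?J)"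
      by (simp only: mult_ac)
    ultimately have "2 * q\<^sup>2 * V_fun Q * (q ^ s * ?J) = q ^ r * (Q ^ t * (2 * V_fun Q * ?J))"
      by (simp only: mult.assoc)
    then have "2 * q\<^sup>2 * V_fun Q * (q ^ s * ?J) / q ^ r = Q ^ t * (2 * V_fun Q * ?J)"
      using q(2) by (simp only: nonzero_mult_div_cancel_left power_not_zero not_False_eq_True)
    then show ?thesis by (simp only: mult_ac)
  qed
  from sum show ?thesis unfolding summand total by (rule has_sum_imp_sums)
qed

section \<open>The four residue classes\<close>

lemma qpoch_inf_0_0: "qpoch_inf 0 0 = 1"
  by (simp add: qpoch_inf_def)

theorem theorem2p4:
  fixes q :: complex
  assumes "norm q < 1"
  shows "(\<lambda>n. of_int (u_num (4 * n)) * q ^ n) sums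
           (2 * q^2 * qpoch_inf (q^16) (q^16) * qpoch_inf (- q) (q^16)
              * qpoch_inf (- (q^15)) (q^16) * V_fun q)
       \<and> (\<lambda>n. of_int (u_num (4 * n + 1)) * q ^ n) sums
           (2 * q * qpoch_inf (q^16) (q^16) * qpoch_inf (- (q^3)) (q^16)
              * qpoch_inf (- (q^13)) (q^16) * V_fun q)
       \<and> (\<lambda>n. of_int (u_num (4 * n + 2)) * q ^ n) sums
           (2 * qpoch_inf (q^16) (q^16) * qpoch_inf (- (q^7)) (q^16)
              * qpoch_inf (- (q^9)) (q^16) * V_fun q)
       \<and> (\<lambda>n. of_int (u_num (4 * n + 3)) * q ^ n) sums
           (2 * qpoch_inf (q^16) (q^16) * qpoch_inf (- (q^5)) (q^16)
              * qpoch_inf (- (q^11)) (q^16) * V_fun q)"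
proof (cases "q = 0")
  case True
  \<comment> \<open>At q = 0 every series reduces to its constant term and every infinite product to
    1.\<close>
  have "V_fun 0 = 1" by (simp add: V_fun_def qpoch_inf_0_0)
  have zero: "(\<lambda>n. of_int (f n) * (0::complex) ^ n) sums of_int (f 0)" for f :: "nat \<Rightarrow> int"
    using powser_sums_zero[of "\<lambda>n. of_int (f n) :: complex"] .
  show ?thesis
    using zero[of "\<lambda>n. u_num (4 * n)"] zero[of "\<lambda>n. u_num (4 * n + 1)"]
      zero[of "\<lambda>n. u_num (4 * n + 2)"] zero[of "\<lambda>n. u_num (4 * n + 3)"] u_num_small
      u_num_small(3)[unfolded numeral_2_eq_2] \<open>V_fun 0 = 1\<close>
    by (simp add: True qpoch_inf_0_0)
next
  case False
  note product = u_num_section_product[OF assms False]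
  have tri_eqI: "tri j = n" if "j * (j - 1) = 2 * int n" for j n
    using two_int_tri[of j] that by simp
  \<comment> \<open>Doubling clears the halves in \<open>tri\<close> and leaves a polynomial
    identity in \<open>i\<close>.\<close>
  have tri_expand: "2 * int (u + 4 * (a * tri (i + 1) + b * tri i)) =
    2 * int u + 4 * (int a * ((i + 1) * i) + int b * (i * (i - 1)))" for u a b i
  proof -
    have "2 * int (u + 4 * (a * tri (i + 1) + b * tri i)) =
      2 * int u + 4 * (int a * (2 * int (tri (i + 1))) + int b * (2 * int (tri i)))"
      by (simp add: algebra_simps)
    then show ?thesis unfolding two_int_tri by simp
  qed
  \<comment> \<open>In each class c is a representative of r + 2 modulo 4 and s = T(2 c). Comparing
    coefficients in \<open>i\<close> gives a = 7 + 4 c and b = 9 - 4 c, and t = (s + 2 - r) /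
    4.\<close>
  have "(\<lambda>n. of_int (u_num (4 * n + 0)) * q ^ n) sums
      (2 * q ^ 2 * qpoch_inf (q ^ 16) (q ^ 16) * qpoch_inf (- (q ^ 15)) (q ^ 16) *
        qpoch_inf (- (q ^ 1)) (q ^ 16) * V_fun q)"
    by (rule product[where c = 2 and s = 6]) (auto intro!: tri_eqI simp only: tri_expand, simp_all add: algebra_simps)
  moreover have "(\<lambda>n. of_int (u_num (4 * n + 1)) * q ^ n) sums
      (2 * q ^ 1 * qpoch_inf (q ^ 16) (q ^ 16) * qpoch_inf (- (q ^ 3)) (q ^ 16) *
        qpoch_inf (- (q ^ 13)) (q ^ 16) * V_fun q)"
    by (rule product[where c = "-1" and s = 3]) (auto intro!: tri_eqI simp only: tri_expand, simp_all add: algebra_simps)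
  moreover have "(\<lambda>n. of_int (u_num (4 * n + 2)) * q ^ n) sums
      (2 * q ^ 0 * qpoch_inf (q ^ 16) (q ^ 16) * qpoch_inf (- (q ^ 7)) (q ^ 16) *
        qpoch_inf (- (q ^ 9)) (q ^ 16) * V_fun q)"
    by (rule product[where c = 0 and s = 0]) (auto intro!: tri_eqI simp only: tri_expand, simp_all add: algebra_simps)
  moreover have "(\<lambda>n. of_int (u_num (4 * n + 3)) * q ^ n) sums
      (2 * q ^ 0 * qpoch_inf (q ^ 16) (q ^ 16) * qpoch_inf (- (q ^ 11)) (q ^ 16) *
        qpoch_inf (- (q ^ 5)) (q ^ 16) * V_fun q)"
    by (rule product[where c = 1 and s = 1]) (auto intro!: tri_eqI simp only: tri_expand, simp_all add: algebra_simps)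
  ultimately show ?thesis by (simp add: mult_ac)
qed

end
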